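(* Consider a sequence, indexed by $N\geq 1$, of Biorthogonal Ensembles satisfying the structural assumption (both described in the context). Assume there exists $\varepsilon>0$ such that for every integer $n\geq 1$, $$\max_{k,m\in\mathbb N:\ \left|\frac kN-1\right|\leq\varepsilon,\ \left|\frac mN-1\right|\leq\varepsilon}\left|\langle xP_{k,N},Q_{m,N}\rangle_{L^2(\mu_N)}\right|=o(N^{1/n})\qquad\text{as }N\to\infty .$$ If there exists a probability measure $\mu^*$ on $\mathbb R$ characterized by its moments such that for all $\ell\in\mathbb N$, $$\lim_{N\to\infty}\int x^\ell\,\nu_N(\mathrm dx)=\int x^\ell\,\mu^*(\mathrm dx),$$ then $\mathbb P$-almost surely $\hat\mu^N$ converges weakly towards $\mu^*$ as $N\to\infty$.
   Context: $\mathbb N=\{0,1,2,\dots\}$. All functions are real-valued and $\langle f,g\rangle_{L^2(\mu)}=\int fg\,\mathrm d\mu$. Biorthogonal Ensemble: for each $N\ge1$ let $\mu_N$ be a Borel measure on $\mathbb R$ and $(P_{k,N})_{k=0}^{N-1}$, $(Q_{k,N})_{k=0}^{N-1}$ two families in $L^2(\mu_N)$ with $\langle P_{k,N},Q_{m,N}\rangle_{L^2(\mu_N)}=\delta_{km}$ for $0\le k,m\le N-1$, such that $$\frac1{N!}\det\big[P_{k-1,N}(x_i)\big]_{i,k=1}^N\det\big[Q_{k-1,N}(x_i)\big]_{i,k=1}^N\prod_{i=1}^N\mu_N(\mathrm dx_i)$$ is a probability measure $\mathbb P_N$ on $\mathbb R^N$. The real random variables $x_1,\dots,x_N$ (depending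 on $N$) have this joint distribution; $\mathbb E$ denotes the corresponding expectation. $\mathbb P$ is the product probability measure on $\bigotimes_{N\ge 1}(\mathbb R^N,\mathbb P_N)$. Structural assumption: (a) for each $N$, the two families can be completed into infinite families $(P_{k,N})_{k\in\mathbb N}$, $(Q_{k,N})_{k\in\mathbb N}$ of $L^2(\mu_N)$ with $\langle P_{k,N},Q_{m,N}\rangle_{L^2(\mu_N)}=\delta_{km}$ for all $k,m\in\mathbb N$ (these completed families are fixed); (b) there is a sequence $(\mathfrak q_N)_{N\ge1}$ of nonnegative integers such that for every integer $n\ge1$, $\mathfrak q_N=o(N^{1/n})$ as $N\to\infty$, and for all $N\ge 1$, $k\in\mathbb N$, the function $x\mapsto xP_{k,N}(x)$ belongs to $\mathrm{Span}(P_{m,N})_{m=0}^{k+\mathfrak q_N}$. Empirical measure: $\hat\mu^N=\frac1N\sum_{i=1}^N\delta_{x_i}$. Average characteristic polynomial: $\chi_N(z)=\mathbb E\big[\prod_{i=1}^N(z-x_i)\big]$, $z\in\mathbb C$, a monic polynomial of degree $N$. Its complex zeros counted with multiplicity are $z_1,\dots,z_N$, and $\nu_N=\frac1N\sum_{i=1}^N\delta_{z_i}$ (so $\int x^\ell\nu_N(\mathrm dx)=\frac1N\sum_i z_i^\ell$). A probability measure on $\mathbb R$ is characterized by its moments if all its moments are finite and it is the only probability measure on $\mathbb R$ with these moments. *)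

theory Defs
  imports "HOL-Probability.Probability" "Jordan_Normal_Form.Determinant"
begin

definition square_integrable :: "'a measure \<Rightarrow> ('a \<Rightarrow> real) \<Rightarrow> bool" where
  "square_integrable M f \<longleftrightarrow> f \<in> borel_measurable M \<and> integrable M (\<lambda>x. (f x)\<^sup>2)"

definition L2_inner :: "'a measure \<Rightarrow> ('a \<Rightarrow> real) \<Rightarrow> ('a \<Rightarrow> real) \<Rightarrow> real" where
  "L2_inner M f g = (LINT x|M. f x * g x)"

text \<open>A point of \<open>\<real>\<^sup>N\<close> is a function \<open>nat \<Rightarrow> real\<close> that matters only on \<open>{..<N}\<close>, as in
  \<^const>\<open>PiM\<close>; coordinates and matrix indices start at 0.\<close>

definition ensemble_density ::
    "nat \<Rightarrow> (nat \<Rightarrow> real \<Rightarrow> real) \<Rightarrow> (nat \<Rightarrow> real \<Rightarrow> real) \<Rightarrow> (nat \<Rightarrow> real) \<Rightarrow> real" where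
  "ensemble_density N P Q x =
     Determinant.det (Matrix.mat N N (\<lambda>(i, k). P k (x i))) *
     Determinant.det (Matrix.mat N N (\<lambda>(i, k). Q k (x i))) / fact N"

text \<open>\<open>M\<close> is not required to be \<open>\<sigma>\<close>-finite. This is harmless: the density vanishes off \<open>S\<^sup>N\<close>, where
  \<open>S\<close> is the set of points at which some \<open>P k\<close>, \<open>k < N\<close>, is nonzero. As these functions are square
  integrable, \<open>M\<close> is \<open>\<sigma>\<close>-finite on \<open>S\<close>, so the product measure is unique on \<open>S\<^sup>N\<close>.\<close>

definition ensemble_measure ::
    "nat \<Rightarrow> real measure \<Rightarrow> (nat \<Rightarrow> real \<Rightarrow> real) \<Rightarrow> (nat \<Rightarrow> real \<Rightarrow> real) \<Rightarrow> (nat \<Rightarrow> real) measure" where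
  "ensemble_measure N M P Q =
     density (Pi\<^sub>M {..<N} (\<lambda>_. M)) (\<lambda>x. ennreal (ensemble_density N P Q x))"

text \<open>The almost-everywhere nonnegativity is part of the requirement that the signed density defines
  a probability measure; it must be stated because \<^const>\<open>ennreal\<close> truncates negative values to 0.\<close>

definition biorthogonal_ensemble ::
    "nat \<Rightarrow> real measure \<Rightarrow> (nat \<Rightarrow> real \<Rightarrow> real) \<Rightarrow> (nat \<Rightarrow> real \<Rightarrow> real) \<Rightarrow> bool" where
  "biorthogonal_ensemble N M P Q \<longleftrightarrow>
     sets M = sets borel \<and>
     (\<forall>k<N. square_integrable M (P k) \<and> square_integrable M (Q k)) \<and>
     (\<forall>k<N. \<forall>m<N. L2_inner M (P k) (Q m) = (if k = m then 1 else 0)) \<and>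
     (AE x in Pi\<^sub>M {..<N} (\<lambda>_. M). 0 \<le> ensemble_density N P Q x) \<and>
     prob_space (ensemble_measure N M P Q)"

text \<open>Membership in the span is an identity between elements of \<open>L\<^sup>2\<close>, hence almost everywhere.\<close>

definition structural_assumption ::
    "(nat \<Rightarrow> real measure) \<Rightarrow> (nat \<Rightarrow> nat \<Rightarrow> real \<Rightarrow> real) \<Rightarrow> (nat \<Rightarrow> nat \<Rightarrow> real \<Rightarrow> real) \<Rightarrow> bool" where
  "structural_assumption \<mu> P Q \<longleftrightarrow>
     (\<forall>N\<ge>1. (\<forall>k. square_integrable (\<mu> N) (P N k) \<and> square_integrable (\<mu> N) (Q N k)) \<and>
            (\<forall>k m. L2_inner (\<mu> N) (P N k) (Q N m) = (if k = m then 1 else 0))) \<and>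
     (\<exists>q :: nat \<Rightarrow> nat.
        (\<forall>n\<ge>1::nat. (\<lambda>N. real (q N)) \<in> o(\<lambda>N. real N powr (1 / real n))) \<and>
        (\<forall>N\<ge>1. \<forall>k. \<exists>c :: nat \<Rightarrow> real.
            AE x in \<mu> N. x * P N k x = (\<Sum>m\<le>k + q N. c m * P N m x)))"

text \<open>Only large \<open>N\<close> matter below: for \<open>N \<ge> 1\<close> the index set is finite and contains \<open>(N, N)\<close>.\<close>

definition max_coeff_near_diagonal ::
    "real \<Rightarrow> nat \<Rightarrow> real measure \<Rightarrow> (nat \<Rightarrow> real \<Rightarrow> real) \<Rightarrow> (nat \<Rightarrow> real \<Rightarrow> real) \<Rightarrow> real" where
  "max_coeff_near_diagonal \<epsilon> N M P Q =
     Max {\<bar>L2_inner M (\<lambda>x. x * P k x) (Q m)\<bar> | k m.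
            \<bar>real k / real N - 1\<bar> \<le> \<epsilon> \<and> \<bar>real m / real N - 1\<bar> \<le> \<epsilon>}"

definition empirical_measure :: "nat \<Rightarrow> (nat \<Rightarrow> real) \<Rightarrow> real measure" where
  "empirical_measure N x = distr (measure_pmf (pmf_of_set {..<N})) borel x"

definition avg_char_fun ::
    "nat \<Rightarrow> real measure \<Rightarrow> (nat \<Rightarrow> real \<Rightarrow> real) \<Rightarrow> (nat \<Rightarrow> real \<Rightarrow> real) \<Rightarrow> complex \<Rightarrow> complex" where
  "avg_char_fun N M P Q z =
     (LINT x|ensemble_measure N M P Q. (\<Prod>i<N. z - complex_of_real (x i)))"

definition avg_char_poly ::
    "nat \<Rightarrow> real measure \<Rightarrow> (nat \<Rightarrow> real \<Rightarrow> real) \<Rightarrow> (nat \<Rightarrow> real \<Rightarrow> real) \<Rightarrow> complex poly" where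
  "avg_char_poly N M P Q = (THE p. \<forall>z. poly p z = avg_char_fun N M P Q z)"

text \<open>\<^const>\<open>proots\<close> is the multiset of zeros, so each zero is weighted by its multiplicity.\<close>

definition zero_distribution ::
    "nat \<Rightarrow> real measure \<Rightarrow> (nat \<Rightarrow> real \<Rightarrow> real) \<Rightarrow> (nat \<Rightarrow> real \<Rightarrow> real) \<Rightarrow> complex pmf" where
  "zero_distribution N M P Q = pmf_of_multiset (proots (avg_char_poly N M P Q))"

definition characterized_by_moments :: "real measure \<Rightarrow> bool" where
  "characterized_by_moments M \<longleftrightarrow>
     (\<forall>l::nat. integrable M (\<lambda>x. x ^ l)) \<and>
     (\<forall>M'. real_distribution M' \<and>
           (\<forall>l::nat. integrable M' (\<lambda>x. x ^ l) \<and> (LINT x|M'. x ^ l) = (LINT x|M. x ^ l))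
         \<longrightarrow> M' = M)"

end

theory Submission
  imports Defs "Jordan_Normal_Form.Schur_Decomposition" "HOL-Real_Asymp.Real_Asymp"
begin

text \<open>Let \<open>A\<close> be the infinite matrix of multiplication by \<open>x\<close>, \<open>A k m = \<langle>x P k, Q m\<rangle>\<close>. By the
recurrence, row \<open>k\<close> of \<open>A\<close> vanishes beyond column \<open>k + q\<close>, and the coefficients \<open>\<langle>x\<^sup>l P k, Q m\<rangle>\<close> are
the entries of \<open>A\<^sup>l\<close>. Both objects to be compared are traces. Write \<open>\<pi>\<close> for the projection on the first
\<open>N\<close> indices. Expanding the two determinants in the density and integrating coordinate by coordinate
gives \<open>E (\<Sum>i. x\<^sub>i\<^sup>l) = Tr (\<pi> A\<^sup>l \<pi>)\<close>, while Andreief's identity shows that the average characteristic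
polynomial is the characteristic polynomial of \<open>\<pi> A \<pi>\<close>, so the zeros satisfy
\<open>\<Sum>i. z\<^sub>i\<^sup>l = Tr ((\<pi> A \<pi>)\<^sup>l)\<close>. The same expansion gives the variance of \<open>\<Sum>i. x\<^sub>i\<^sup>l\<close> as the sum of
\<open>(A\<^sup>l) k m * (A\<^sup>l) m k\<close> over \<open>k < N \<le> m\<close>.

The difference of the two traces, and the variance, only involve walks of length at most \<open>2 l\<close> that
cross the level \<open>N\<close> and come back to their starting point. A walk may jump down arbitrarily far, but
climbs by at most \<open>q\<close> per step; since it has to climb back whatever it descends, it stays within
\<open>2 l q\<close> of \<open>N\<close>. Hence only entries of \<open>A\<close> near the diagonal position \<open>(N, N)\<close> occur, and the number of
walks is bounded by a power of \<open>4 l q + 1\<close>. As both \<open>q\<close> and these entries grow slower than every power of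
\<open>N\<close>, the difference and the variance are \<open>O(N powr (1/2))\<close>
(\<open>trace_power_difference\<close>, \<open>variance_sum_bound\<close>, \<open>subpolynomial_product_bounds\<close>).

After division by \<open>N\<close>, the mean of the \<open>l\<close>-th empirical moment has the same limit as the \<open>l\<close>-th moment of
the zeros, and its variance is summable in \<open>N\<close>. Summability of the second moments yields almost sure
convergence of all empirical moments
(\<open>AE_tendsto_zero_of_summable_second_moments\<close>), and the method of moments turns this into weak
convergence, because the limit is determined by its moments.\<close>

section \<open>The method of moments\<close>

lemma real_distribution_tightI_second_moment:
  fixes \<mu> :: "nat \<Rightarrow> real measure"
  assumes dist: "\<And>n. real_distribution (\<mu> n)"
    and int: "\<And>n. integrable (\<mu> n) (\<lambda>x. x\<^sup>2)"
    and bound: "\<And>n. (LINT x|\<mu> n. x\<^sup>2) \<le> B"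
  shows "tight \<mu>"
  unfolding tight_def
proof (intro conjI allI impI dist)
  fix e :: real assume e: "e > 0"
  define K where "K = sqrt ((\<bar>B\<bar> + 1) / e) + 1"
  have K: "K > 0" "K\<^sup>2 > (\<bar>B\<bar> + 1) / e"
  proof -
    show "K > 0" unfolding K_def using e by (simp add: add_nonneg_pos)
    have "(\<bar>B\<bar> + 1) / e = (sqrt ((\<bar>B\<bar> + 1) / e))\<^sup>2" using e by simp
    also have "\<dots> < K\<^sup>2" unfolding K_def using e by (intro power_strict_mono) auto
    finally show "K\<^sup>2 > (\<bar>B\<bar> + 1) / e" .
  qed
  have "measure (\<mu> n) {-K<..K} > 1 - e" for n
  proof -
    interpret real_distribution "\<mu> n" by fact
    have "prob {x \<in> space (\<mu> n). K\<^sup>2 \<le> x\<^sup>2} \<le> (LINT x|\<mu> n. x\<^sup>2) / K\<^sup>2"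
      using int K by (intro integral_Markov_inequality_measure[where A="{}"]) auto
    also have "\<dots> \<le> \<bar>B\<bar> / K\<^sup>2"
      using bound[of n] by (intro divide_right_mono) auto
    also have "\<dots> < e"
    proof -
      have "\<bar>B\<bar> + 1 < K\<^sup>2 * e" using K e by (simp add: field_simps)
      then show ?thesis using K by (simp add: field_simps)
    qed
    finally have *: "prob {x \<in> space (\<mu> n). K\<^sup>2 \<le> x\<^sup>2} < e" .
    have "1 - prob {-K<..K} = prob (space (\<mu> n) - {-K<..K})"
      by (subst prob_compl) auto
    also have "\<dots> \<le> prob {x \<in> space (\<mu> n). K\<^sup>2 \<le> x\<^sup>2}"
    proof (rule finite_measure_mono)
      show "space (\<mu> n) - {- K<..K} \<subseteq> {x \<in> space (\<mu> n). K\<^sup>2 \<le> x\<^sup>2}"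
        using K by (auto simp: abs_le_square_iff[symmetric])
    qed simp
    finally show ?thesis using * by linarith
  qed
  then show "\<exists>a b. a < b \<and> (\<forall>n. 1 - e < measure (\<mu> n) {a<..b})"
    using K by (intro exI[of _ "-K"] exI[of _ K]) auto
qed

text \<open>Used to replace the unbounded test function \<open>x\<^sup>l\<close> by a bounded one: where the truncation is active,
\<open>K < \<bar>x\<bar>\<close>, an extra factor \<open>(\<bar>x\<bar> / K)\<^sup>l\<close> is at least 1. The bound by an even moment makes the
error uniform along a sequence with convergent moments.\<close>

lemma clamp_power_error:
  fixes x K :: real
  assumes "K > 0" "l \<ge> 1"
  shows "\<bar>x ^ l - (max (-K) (min x K)) ^ l\<bar> \<le> 2 * x ^ (2 * l) / K ^ l"
proof (cases "\<bar>x\<bar> \<le> K")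
  case True
  then have "max (-K) (min x K) = x" by auto
  then show ?thesis using assms by simp
next
  case False
  define y where "y = max (-K) (min x K)"
  have y: "\<bar>y\<bar> \<le> \<bar>x\<bar>" using False assms unfolding y_def by auto
  have "\<bar>x ^ l - y ^ l\<bar> \<le> \<bar>x\<bar> ^ l + \<bar>y\<bar> ^ l"
    using abs_triangle_ineq4[of "x^l" "y^l"] by (simp add: power_abs)
  also have "\<dots> \<le> 2 * \<bar>x\<bar> ^ l" using power_mono[OF y, of l] by simp
  also have "\<dots> \<le> 2 * \<bar>x\<bar> ^ l * (\<bar>x\<bar> ^ l / K ^ l)"
  proof -
    have "1 \<le> \<bar>x\<bar> ^ l / K ^ l"
      using power_mono[of K "\<bar>x\<bar>" l] False assms by (simp add: field_simps)
    then show ?thesis by (metis abs_ge_zero mult_le_cancel_left1 mult_nonneg_nonneg not_le zero_le_numeral zero_le_power)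
  qed
  also have "\<dots> = 2 * x ^ (2 * l) / K ^ l"
    by (simp add: power_mult power2_eq_square power_mult_distrib flip: power_abs)
  finally show ?thesis unfolding y_def .
qed

text \<open>Weak convergence alone only controls bounded continuous functions. Even moments of the limit are finite
by monotone convergence from \<open>min (x\<^sup>2\<^sup>k) K\<close>; then all moments pass to the limit because truncation
at height \<open>K\<close> costs an error of order \<open>1 / K\<^sup>l\<close> uniformly in \<open>n\<close>.\<close>

lemma weak_limit_moments:
  fixes \<mu> :: "nat \<Rightarrow> real measure"
  assumes dist: "\<And>n. real_distribution (\<mu> n)" and \<nu>: "real_distribution \<nu>"
    and weak: "weak_conv_m \<mu> \<nu>"
    and int: "\<And>n l. integrable (\<mu> n) (\<lambda>x. x ^ l)"
    and lim: "\<And>l::nat. (\<lambda>n. LINT x|\<mu> n. x ^ l) \<longlonglongrightarrow> m l"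
  shows "integrable \<nu> (\<lambda>x. x ^ l)" "(LINT x|\<nu>. x ^ l) = m l"
proof -
  interpret \<nu>: real_distribution \<nu> by fact
  interpret \<mu>: real_distribution "\<mu> n" for n by fact
  interpret right: real_distribution \<nu> by fact
  have even_int: "integrable \<nu> (\<lambda>x. x ^ (2*k))" and even_le: "(LINT x|\<nu>. x ^ (2*k)) \<le> m (2*k)" for k
  proof -
    define f where "f K x = min (x ^ (2*k)) (real K)" for K x
    have f_meas[measurable]: "f K \<in> borel_measurable borel" for K
      unfolding f_def by measurable
    have f_le: "(LINT x|\<nu>. f K x) \<le> m (2*k)" for K
    proof (rule LIMSEQ_le)
      show "(\<lambda>n. LINT x|\<mu> n. f K x) \<longlonglongrightarrow> (LINT x|\<nu>. f K x)"
        by (rule weak_conv_imp_integral_bdd_continuous_conv[OF dist \<nu> weak, where B="real K"])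
           (auto simp: f_def intro!: continuous_intros)
      show "\<exists>N. \<forall>n\<ge>N. (LINT x|\<mu> n. f K x) \<le> (LINT x|\<mu> n. x ^ (2*k))"
      proof (intro exI[of _ 0] allI impI integral_mono int)
        show "integrable (\<mu> n) (f K)" for n
          by (rule \<mu>.integrable_const_bound[where B="real K"]) (auto simp: f_def[abs_def])
      qed (simp add: f_def)
    qed (rule lim)
    have f_int: "integrable \<nu> (f K)" for K
      by (rule \<nu>.integrable_const_bound[where B="real K"]) (auto simp: f_def[abs_def])
    have "(\<integral>\<^sup>+x. ennreal (x ^ (2*k)) \<partial>\<nu>) = (\<integral>\<^sup>+x. (SUP K. ennreal (f K x)) \<partial>\<nu>)"
    proof (intro nn_integral_cong)
      fix x :: real
      obtain K where "x ^ (2*k) \<le> real K" using real_arch_simple by blast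
      then have "f K x = x ^ (2*k)" by (simp add: f_def)
      then have "ennreal (x ^ (2*k)) \<le> (SUP K. ennreal (f K x))"
        by (metis SUP_upper UNIV_I)
      moreover have "(SUP K. ennreal (f K x)) \<le> ennreal (x ^ (2*k))"
        by (intro SUP_least ennreal_leI) (simp add: f_def)
      ultimately show "ennreal (x ^ (2*k)) = (SUP K. ennreal (f K x))" by (rule antisym)
    qed
    also have "\<dots> = (SUP K. \<integral>\<^sup>+x. ennreal (f K x) \<partial>\<nu>)"
      by (intro nn_integral_monotone_convergence_SUP)
         (auto simp: incseq_def le_fun_def f_def intro!: ennreal_leI)
    also have "\<dots> \<le> ennreal (m (2*k))"
    proof (intro SUP_least)
      fix K
      show "(\<integral>\<^sup>+x. ennreal (f K x) \<partial>\<nu>) \<le> ennreal (m (2*k))"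
        by (subst nn_integral_eq_integral[OF f_int]) (auto intro!: ennreal_leI f_le simp: f_def)
    qed
    finally have fin: "(\<integral>\<^sup>+x. ennreal (x ^ (2*k)) \<partial>\<nu>) \<le> ennreal (m (2*k))" .
    show I: "integrable \<nu> (\<lambda>x. x ^ (2*k))"
      using fin by (intro integrableI_nonneg) (auto simp: less_top[symmetric] top_unique)
    have m0: "m (2*k) \<ge> 0"
      by (rule LIMSEQ_le_const[OF lim]) (auto intro!: integral_nonneg)
    show "(LINT x|\<nu>. x ^ (2*k)) \<le> m (2*k)"
      using fin m0 by (subst (asm) nn_integral_eq_integral[OF I]) auto
  qed
  have abs_le: "\<bar>x ^ l\<bar> \<le> 1 + x ^ (2 * l)" for x :: real and l
  proof -
    have "0 \<le> (\<bar>x ^ l\<bar> - 1)\<^sup>2" by simp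
    also have "\<dots> = x ^ (2 * l) - 2 * \<bar>x ^ l\<bar> + 1"
      by (simp add: power2_diff power_mult[symmetric] mult.commute)
    finally show ?thesis using abs_ge_zero[of "x^l"] by linarith
  qed
  show I: "integrable \<nu> (\<lambda>x. x ^ l)" for l
    by (rule Bochner_Integration.integrable_bound[OF Bochner_Integration.integrable_add[OF \<nu>.integrable_const[of 1] even_int[of l]]])
       (use abs_le in \<open>auto simp: abs_of_nonneg\<close>)
  show "(LINT x|\<nu>. x ^ l) = m l"
  proof (cases "l = 0")
    case True
    have "(\<lambda>n. LINT x|\<mu> n. x ^ 0) = (\<lambda>n. 1)" using \<mu>.prob_space by simp
    with lim[of 0] have "m 0 = 1" by (simp add: LIMSEQ_const_iff)
    then show ?thesis using True \<nu>.prob_space by simp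
  next
    case False
    then have l: "l \<ge> 1" by simp
    have close: "\<bar>(LINT x|\<nu>. x ^ l) - m l\<bar> \<le> 4 * m (2 * l) / K ^ l" if K: "K > 0" for K
    proof -
      define g where "g x = (max (-K) (min x K)) ^ l" for x
      have g_bd: "norm (g x) \<le> K ^ l" for x
        unfolding g_def using K by (auto simp: power_abs intro!: power_mono)
      have g_meas[measurable]: "g \<in> borel_measurable borel" unfolding g_def by measurable
      have conv: "(\<lambda>n. LINT x|\<mu> n. g x) \<longlonglongrightarrow> (LINT x|\<nu>. g x)"
        by (rule weak_conv_imp_integral_bdd_continuous_conv[OF dist \<nu> weak _ g_bd])
           (auto simp: g_def intro!: continuous_intros)
      have err: "\<bar>(LINT x|M. x ^ l) - (LINT x|M. g x)\<bar> \<le> 2 * (LINT x|M. x ^ (2*l)) / K ^ l"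
        if M: "real_distribution M" "\<And>l. integrable M (\<lambda>x. x ^ l)" for M
      proof -
        interpret M: real_distribution M by fact
        have gi: "integrable M g"
          by (rule M.integrable_const_bound[where B="K ^ l"]) (use g_bd in auto)
        have "\<bar>(LINT x|M. x ^ l) - (LINT x|M. g x)\<bar> = \<bar>LINT x|M. x ^ l - g x\<bar>"
          using M gi by simp
        also have "\<dots> \<le> (LINT x|M. \<bar>x ^ l - g x\<bar>)" by (rule integral_abs_bound)
        also have "\<dots> \<le> (LINT x|M. 2 * x ^ (2 * l) / K ^ l)"
          using clamp_power_error[OF K l]
          by (intro integral_mono integrable_abs Bochner_Integration.integrable_diff M gi
              integrable_divide integrable_mult_right) (auto simp: g_def)
        finally show ?thesis by simp
      qed
      have "\<bar>(LINT x|\<nu>. g x) - m l\<bar> \<le> 2 * m (2 * l) / K ^ l"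
      proof (rule LIMSEQ_le)
        show "(\<lambda>n. \<bar>(LINT x|\<mu> n. g x) - (LINT x|\<mu> n. x ^ l)\<bar>) \<longlonglongrightarrow> \<bar>(LINT x|\<nu>. g x) - m l\<bar>"
          by (intro tendsto_intros conv lim)
        show "(\<lambda>n. 2 * (LINT x|\<mu> n. x ^ (2*l)) / K ^ l) \<longlonglongrightarrow> 2 * m (2 * l) / K ^ l"
          using K by (intro tendsto_intros lim) auto
        show "\<exists>N. \<forall>n\<ge>N. \<bar>(LINT x|\<mu> n. g x) - (LINT x|\<mu> n. x ^ l)\<bar> \<le> 2 * (LINT x|\<mu> n. x ^ (2*l)) / K ^ l"
          using err[OF dist int] by (simp add: abs_minus_commute)
      qed
      moreover have "\<bar>(LINT x|\<nu>. x ^ l) - (LINT x|\<nu>. g x)\<bar> \<le> 2 * m (2*l) / K ^ l"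
      proof -
        have "2 * (LINT x|\<nu>. x ^ (2*l)) / K ^ l \<le> 2 * m (2*l) / K ^ l"
          using even_le[of l] K by (intro divide_right_mono) auto
        with err[OF \<nu> I] show ?thesis by linarith
      qed
      ultimately show ?thesis by (simp add: abs_le_iff)
    qed
    have "((\<lambda>K. 4 * m (2 * l) / K ^ l) \<longlongrightarrow> 0) at_top"
      using l by (intro tendsto_divide_0[OF tendsto_const] filterlim_at_top_imp_at_infinity
          filterlim_pow_at_top filterlim_ident) auto
    moreover have "eventually (\<lambda>K. \<bar>(LINT x|\<nu>. x ^ l) - m l\<bar> \<le> 4 * m (2 * l) / K ^ l) at_top"
      using eventually_gt_at_top[of "0::real"] by eventually_elim (rule close)
    ultimately have "\<bar>(LINT x|\<nu>. x ^ l) - m l\<bar> \<le> 0"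
      by (rule tendsto_lowerbound) simp
    then show ?thesis by simp
  qed
qed

text \<open>Bounded second moments give tightness. Every weak limit along a subsequence has the moments of \<open>M\<close>, hence
is \<open>M\<close>, so the whole sequence converges to \<open>M\<close>.\<close>

theorem method_of_moments:
  fixes \<mu> :: "nat \<Rightarrow> real measure"
  assumes dist: "\<And>n. real_distribution (\<mu> n)" and M: "real_distribution M"
    and det: "characterized_by_moments M"
    and int: "\<And>n l. integrable (\<mu> n) (\<lambda>x. x ^ l)"
    and lim: "\<And>l::nat. (\<lambda>n. LINT x|\<mu> n. x ^ l) \<longlonglongrightarrow> (LINT x|M. x ^ l)"
  shows "weak_conv_m \<mu> M"
proof -
  have "Bseq (\<lambda>n. LINT x|\<mu> n. x ^ 2)" using lim[of 2] convergent_imp_Bseq convergentI by blast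
  then obtain B where "\<And>n. norm (LINT x|\<mu> n. x ^ 2) \<le> B" by (auto simp: Bseq_def)
  then have "tight \<mu>"
    by (intro real_distribution_tightI_second_moment dist int) (auto intro: order_trans[OF abs_ge_self])
  then show ?thesis
  proof (rule tight_subseq_weak_converge[OF dist M])
    fix s :: "nat \<Rightarrow> nat" and \<nu>
    assume s: "strict_mono s" and \<nu>: "real_distribution \<nu>" and w: "weak_conv_m (\<mu> \<circ> s) \<nu>"
    have lim': "(\<lambda>n. LINT x|(\<mu> \<circ> s) n. x ^ l) \<longlonglongrightarrow> (LINT x|M. x ^ l)" for l
      using LIMSEQ_subseq_LIMSEQ[OF lim s] by (simp add: comp_def)
    have d: "real_distribution ((\<mu> \<circ> s) n)" and i: "integrable ((\<mu> \<circ> s) n) (\<lambda>x. x ^ l)" for n l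
      using dist int by simp_all
    note wl = weak_limit_moments[OF d \<nu> w i lim']
    have "\<nu> = M"
      using det wl \<nu> unfolding characterized_by_moments_def by blast
    then show "weak_conv_m (\<mu> \<circ> s) M" using w by simp
  qed
qed

section \<open>Integrating products against a product measure\<close>

text \<open>The usual product formula for boxes needs \<open>\<sigma>\<close>-finite factors, which guarantee that a product measure exists.
By definition, \<^const>\<open>PiM\<close> is some measure with the right values on boxes whenever there is one, and the
zero measure otherwise; being nonzero therefore already forces the formula.\<close>

lemma emeasure_PiM_box_of_nonzero:
  assumes fin: "finite I" and ne: "I \<noteq> {}"
    and nonzero: "emeasure (PiM I M) (space (PiM I M)) \<noteq> 0"
    and A: "\<And>i. i \<in> I \<Longrightarrow> A i \<in> sets (M i)"
  shows "emeasure (PiM I M) (PiE I A) = (\<Prod>i\<in>I. emeasure (M i) (A i))"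
proof -
  let ?\<Omega> = "\<Pi>\<^sub>E i\<in>I. space (M i)"
  let ?J = "{(J, X). (J \<noteq> {} \<or> I = {}) \<and> finite J \<and> J \<subseteq> I \<and> X \<in> (\<Pi> j\<in>J. sets (M j))}"
  let ?G = "\<lambda>(J, X). prod_emb I M J (\<Pi>\<^sub>E j\<in>J. X j)"
  let ?m = "\<lambda>(J, X). \<Prod>j\<in>J \<union> {i\<in>I. emeasure (M i) (space (M i)) \<noteq> 1}.
      if j \<in> J then emeasure (M j) (X j) else emeasure (M j) (space (M j))"
  have sub: "?G ` ?J \<subseteq> Pow ?\<Omega>"
    using prod_algebra_sets_into_space[of I M] by (simp add: prod_algebra_def)
  have ext: "\<exists>\<mu>'. (\<forall>i\<in>?J. \<mu>' (?G i) = ?m i) \<and> measure_space ?\<Omega> (sigma_sets ?\<Omega> (?G ` ?J)) \<mu>'"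
  proof (rule ccontr)
    assume no: "\<not> ?thesis"
    have "PiM I M = measure_of ?\<Omega> (?G ` ?J) (\<lambda>_. 0)"
      unfolding PiM_def extend_measure_def by (rule if_not_P) (rule notI, erule conjE, rule notE[OF no])
    then have "emeasure (PiM I M) (space (PiM I M)) = 0"
      by (simp only: emeasure_sigma)
    with nonzero show False ..
  qed
  then obtain \<mu>' where \<mu>'_all: "\<forall>i\<in>?J. \<mu>' (?G i) = ?m i"
    and \<mu>': "measure_space ?\<Omega> (sigma_sets ?\<Omega> (?G ` ?J)) \<mu>'" by (elim exE conjE)
  have IA: "(I, A) \<in> ?J" using fin ne A by auto
  have "emeasure (PiM I M) (?G (I, A)) = ?m (I, A)"
  proof (rule emeasure_extend_measure[OF PiM_def _ sub _ _ IA])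
    show "\<mu>' (?G i) = ?m i" if "i \<in> ?J" for i by (rule bspec[OF \<mu>'_all that])
    have S: "sets (PiM I M) = sigma_sets ?\<Omega> (?G ` ?J)"
      unfolding PiM_def by (rule sets_extend_measure[OF sub])
    show "positive (sets (PiM I M)) \<mu>'" "countably_additive (sets (PiM I M)) \<mu>'"
      unfolding S using \<mu>'[unfolded measure_space_def] by (iprover elim: conjE)+
  qed
  moreover have "?G (I, A) = PiE I A"
    by (simp only: prod.case) (rule prod_emb_PiE_same_index[OF sets.sets_into_space[OF A]])
  moreover have "?m (I, A) = (\<Prod>i\<in>I. emeasure (M i) (A i))"
    by (simp only: prod.case) (rule prod.cong, auto)
  ultimately show ?thesis by (simp only:)
qed

text \<open>The sets \<open>{x. norm (g x) \<ge> 1 / Suc n}\<close> have finite measure by Markov's inequality and exhaust the support of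
\<open>g\<close>.\<close>

lemma sigma_finite_density_support:
  fixes g :: "'a \<Rightarrow> 'b :: {banach, second_countable_topology}"
  assumes g: "integrable M g"
  shows "sigma_finite_measure (density M (indicator {x \<in> space M. g x \<noteq> 0}))"
    (is "sigma_finite_measure (density M (indicator ?S))")
proof
  note [measurable] = borel_measurable_integrable[OF g]
  let ?A = "\<lambda>n. {x \<in> space M. norm (g x) \<ge> 1 / Suc n}"
  let ?N = "space M - ?S"
  have ind: "emeasure (density M (indicator ?S)) A = emeasure M (A \<inter> ?S)" if "A \<in> sets M" for A
    using that by (simp add: emeasure_restricted Int_commute)
  show "\<exists>A. countable A \<and> A \<subseteq> sets (density M (indicator ?S)) \<and>
      \<Union> A = space (density M (indicator ?S)) \<and> (\<forall>a\<in>A. emeasure (density M (indicator ?S)) a \<noteq> \<infinity>)"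
  proof (intro exI[of _ "insert ?N (range ?A)"] conjI ballI)
    show "\<Union> (insert ?N (range ?A)) = space (density M (indicator ?S))"
    proof -
      have "\<exists>n. norm (g x) \<ge> 1 / Suc n" if "g x \<noteq> 0" for x
      proof -
        have "norm (g x) > 0" using that by simp
        from reals_Archimedean[OF this] obtain n where "inverse (real (Suc n)) < norm (g x)" ..
        then show ?thesis by (intro exI[of _ n]) (simp add: inverse_eq_divide)
      qed
      then show ?thesis by auto
    qed
    fix a assume "a \<in> insert ?N (range ?A)"
    then show "emeasure (density M (indicator ?S)) a \<noteq> \<infinity>"
    proof
      assume "a = ?N"
      moreover have "?N \<inter> ?S = {}" by blast
      ultimately show ?thesis by (subst ind) simp_all
    next
      assume "a \<in> range ?A"
      then obtain n where a: "a = ?A n" by auto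
      have "emeasure M (?A n) < \<infinity>"
      proof -
        \<comment> \<open>Markov with the constant \<open>Suc n\<close>, in the form provided for nonnegative integrals\<close>
        have "emeasure M {x\<in>space M. 1 \<le> ennreal (Suc n) * ennreal (norm (g x))}
            \<le> ennreal (Suc n) * (\<integral>\<^sup>+x. ennreal (norm (g x)) * indicator (space M) x \<partial>M)"
          by (rule nn_integral_Markov_inequality) auto
        also have "\<dots> = ennreal (Suc n) * (\<integral>\<^sup>+x. ennreal (norm (g x)) \<partial>M)"
          by (intro arg_cong2[where f="(*)"] nn_integral_cong) auto
        also have "\<dots> < \<infinity>" using g by (auto simp: integrable_iff_bounded ennreal_mult_less_top)
        also have "{x\<in>space M. 1 \<le> ennreal (Suc n) * ennreal (norm (g x))} = ?A n"
        proof -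
          have "1 \<le> ennreal (Suc n) * ennreal (norm (g x)) \<longleftrightarrow> 1 / Suc n \<le> norm (g x)" for x
          proof -
            have "ennreal (Suc n) * ennreal (norm (g x)) = ennreal (Suc n * norm (g x))"
              by (simp add: ennreal_mult)
            then have "1 \<le> ennreal (Suc n) * ennreal (norm (g x)) \<longleftrightarrow> 1 \<le> Suc n * norm (g x)"
              using ennreal_le_iff[of "Suc n * norm (g x)" 1] by simp
            then show ?thesis by (simp add: field_simps)
          qed
          then show ?thesis by simp
        qed
        finally show ?thesis .
      qed
      moreover have "emeasure M (?A n \<inter> ?S) \<le> emeasure M (?A n)" by (rule emeasure_mono) auto
      moreover have "?A n \<in> sets M" by measurable
      ultimately show ?thesis unfolding a by (subst ind) (auto simp: less_top)
    qed
  next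
    have "?A n \<in> sets M" for n by measurable
    moreover have "?N \<in> sets M" by measurable
    ultimately show "insert ?N (range ?A) \<subseteq> sets (density M (indicator ?S))" by auto
    show "countable (insert ?N (range ?A))" by simp
  qed
qed

lemma density_indicator_support:
  fixes f :: "'a \<Rightarrow> 'b :: {banach, second_countable_topology}"
  assumes A: "A \<in> sets M" and supp: "\<And>x. x \<in> space M \<Longrightarrow> indicator A x *\<^sub>R f x = f x"
    and f: "f \<in> borel_measurable M"
  shows "integrable (density M (indicator A)) f \<longleftrightarrow> integrable M f"
    and "integral\<^sup>L (density M (indicator A)) f = integral\<^sup>L M f"
proof -
  have d: "density M (indicator A) = density M (\<lambda>x. ennreal (indicator A x))"
    by (simp add: ennreal_indicator)
  have "integrable (density M (indicator A)) f \<longleftrightarrow> integrable M (\<lambda>x. indicator A x *\<^sub>R f x)"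
    unfolding d using A f by (intro integrable_density) auto
  also have "\<dots> \<longleftrightarrow> integrable M f" by (intro Bochner_Integration.integrable_cong supp refl)
  finally show "integrable (density M (indicator A)) f \<longleftrightarrow> integrable M f" .
  have "integral\<^sup>L (density M (indicator A)) f = (\<integral>x. indicator A x *\<^sub>R f x \<partial>M)"
    unfolding d using A f by (intro integral_density) auto
  also have "\<dots> = integral\<^sup>L M f" by (intro Bochner_Integration.integral_cong supp refl)
  finally show "integral\<^sup>L (density M (indicator A)) f = integral\<^sup>L M f" .
qed

text \<open>Fubini for product functions without \<open>\<sigma>\<close>-finiteness of the factors. The integrand vanishes off the box of
the supports of the \<open>g i\<close>, and on these supports the factors are \<open>\<sigma>\<close>-finite because the \<open>g i\<close> are
integrable. Restricted to that box, the given product measure is the unique product of the restricted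
factors.\<close>

lemma integral_PiM_prod:
  fixes g :: "'i \<Rightarrow> 'a \<Rightarrow> 'b :: {real_normed_field, banach, second_countable_topology}"
  assumes fin: "finite I" and ne: "I \<noteq> {}"
    and nonzero: "emeasure (PiM I M) (space (PiM I M)) \<noteq> 0"
    and g: "\<And>i. i \<in> I \<Longrightarrow> integrable (M i) (g i)"
  shows "integrable (PiM I M) (\<lambda>x. \<Prod>i\<in>I. g i (x i))"
    and "(\<integral>x. (\<Prod>i\<in>I. g i (x i)) \<partial>PiM I M) = (\<Prod>i\<in>I. integral\<^sup>L (M i) (g i))"
proof -
  \<comment> \<open>Outside \<open>I\<close> the support is empty and the factor becomes the zero measure, since
    \<open>product_sigma_finite\<close> asks for \<open>\<sigma>\<close>-finiteness at every index.\<close>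
  define S where "S i = {x \<in> space (M i). i \<in> I \<and> g i x \<noteq> 0}" for i
  define M' where "M' i = density (M i) (indicator (S i))" for i
  have S_sets[measurable]: "S i \<in> sets (M i)" for i
  proof (cases "i \<in> I")
    case True
    note [measurable] = borel_measurable_integrable[OF g[OF True]]
    show ?thesis unfolding S_def using True by simp
  qed (simp add: S_def)
  have sets_M'[simp]: "sets (M' i) = sets (M i)" for i by (simp add: M'_def)
  have em: "emeasure (M' i) A = emeasure (M i) (A \<inter> S i)" if "A \<in> sets (M i)" for A i
    using that unfolding M'_def
    by (simp add: emeasure_restricted Int_commute)
  have sf: "sigma_finite_measure (M' i)" for i
  proof (cases "i \<in> I")
    case True
    then show ?thesis using sigma_finite_density_support[OF g[OF True]] by (simp add: M'_def S_def)
  next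
    case False
    then have "emeasure (M' i) (space (M' i)) = 0"
      using em[of "space (M i)" i] by (simp add: S_def M'_def)
    then show ?thesis by (intro finite_measure.axioms(1) finite_measureI) auto
  qed
  interpret P: product_sigma_finite M' by (rule product_sigma_finite.intro) (rule sf)
  have box[measurable]: "PiE I S \<in> sets (PiM I M)" by (rule sets_PiM_I_finite[OF fin]) simp
  have eq: "density (PiM I M) (indicator (PiE I S)) = PiM I M'"
  proof (rule P.PiM_eqI[OF fin])
    show "sets (density (PiM I M) (indicator (PiE I S))) = sets (PiM I M')"
      by (simp cong: sets_PiM_cong)
    fix A assume A: "\<And>i. i \<in> I \<Longrightarrow> A i \<in> sets (M' i)"
    then have A': "\<And>i. i \<in> I \<Longrightarrow> A i \<in> sets (M i)" by simp
    then have [measurable]: "PiE I A \<in> sets (PiM I M)" by (intro sets_PiM_I_finite fin)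
    have "emeasure (density (PiM I M) (indicator (PiE I S))) (PiE I A) = emeasure (PiM I M) (PiE I A \<inter> PiE I S)"
      by (simp add: emeasure_restricted Int_commute)
    also have "PiE I A \<inter> PiE I S = PiE I (\<lambda>i. A i \<inter> S i)" by (rule PiE_Int)
    also have "emeasure (PiM I M) \<dots> = (\<Prod>i\<in>I. emeasure (M i) (A i \<inter> S i))"
      using A' by (intro emeasure_PiM_box_of_nonzero fin ne nonzero) auto
    also have "\<dots> = (\<Prod>i\<in>I. emeasure (M' i) (A i))"
      using A' by (intro prod.cong refl) (simp add: em)
    finally show "emeasure (density (PiM I M) (indicator (PiE I S))) (PiE I A) = (\<Prod>i\<in>I. emeasure (M' i) (A i))" .
  qed
  have meas: "(\<lambda>x. \<Prod>i\<in>I. g i (x i)) \<in> borel_measurable (PiM I M)"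
    using g by (intro borel_measurable_prod measurable_compose[OF measurable_component_singleton]) auto
  have ind: "indicator (S i) x *\<^sub>R g i x = g i x" if "i \<in> I" "x \<in> space (M i)" for i x
    using that by (auto simp: S_def split: split_indicator)
  have indp: "indicator (PiE I S) x *\<^sub>R (\<Prod>i\<in>I. g i (x i)) = (\<Prod>i\<in>I. g i (x i))"
    if "x \<in> space (PiM I M)" for x
  proof (cases "x \<in> PiE I S")
    case False
    with that obtain i where "i \<in> I" "x i \<notin> S i" "x i \<in> space (M i)"
      by (auto simp: space_PiM PiE_iff)
    then have "g i (x i) = 0" by (auto simp: S_def)
    then have "(\<Prod>i\<in>I. g i (x i)) = 0" using \<open>i \<in> I\<close> fin by (auto simp: prod_zero_iff)
    then show ?thesis by simp
  qed simp
  have g': "integrable (M' i) (g i)" "integral\<^sup>L (M' i) (g i) = integral\<^sup>L (M i) (g i)" if "i \<in> I" for i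
    unfolding M'_def using density_indicator_support[OF S_sets ind[OF that]] g[OF that] that by auto
  have "integrable (PiM I M') (\<lambda>x. \<Prod>i\<in>I. g i (x i))"
    by (rule P.product_integrable_prod[OF fin g'(1)])
  then show "integrable (PiM I M) (\<lambda>x. \<Prod>i\<in>I. g i (x i))"
    unfolding eq[symmetric] using density_indicator_support(1)[OF box indp meas] by simp
  have "(\<integral>x. (\<Prod>i\<in>I. g i (x i)) \<partial>PiM I M) = (\<integral>x. (\<Prod>i\<in>I. g i (x i)) \<partial>PiM I M')"
    unfolding eq[symmetric] using density_indicator_support(2)[OF box indp meas] by simp
  also have "\<dots> = (\<Prod>i\<in>I. integral\<^sup>L (M' i) (g i))"
    by (rule P.product_integral_prod[OF fin g'(1)])
  finally show "(\<integral>x. (\<Prod>i\<in>I. g i (x i)) \<partial>PiM I M) = (\<Prod>i\<in>I. integral\<^sup>L (M i) (g i))"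
    by (simp add: g'(2))
qed

section \<open>Expectations under a biorthogonal ensemble\<close>

lemma det_mat_permutation_sum:
  "Determinant.det (Matrix.mat N N (\<lambda>(i, k). F i k)) =
     (\<Sum>p | p permutes {..<N}. of_int (sign p) * (\<Prod>i<N. F i (p i)))"
proof -
  have "Determinant.det (Matrix.mat N N (\<lambda>(i, k). F i k)) =
      (\<Sum>p | p permutes {0..<N}. of_int (sign p) * (\<Prod>i = 0..<N. Matrix.mat N N (\<lambda>(i, k). F i k) $$ (i, p i)))"
    by (rule det_def') simp
  also have "\<dots> = (\<Sum>p | p permutes {0..<N}. of_int (sign p) * (\<Prod>i = 0..<N. F i (p i)))"
    by (intro sum.cong arg_cong2[where f="(*)"] prod.cong refl) (auto dest: permutes_in_image)
  finally show ?thesis by (simp add: atLeast0LessThan)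
qed

lemma ensemble_density_permutation_sum:
  "ensemble_density N P Q x = (\<Sum>p | p permutes {..<N}. \<Sum>r | r permutes {..<N}.
      of_int (sign p * sign r) / fact N * (\<Prod>i<N. P (p i) (x i) * Q (r i) (x i)))"
  unfolding ensemble_density_def det_mat_permutation_sum
  by (simp add: sum_product sum_divide_distrib prod.distrib ac_simps)

lemma measurable_PiM_coordinate:
  "i \<in> I \<Longrightarrow> u \<in> measurable M N \<Longrightarrow> (\<lambda>x. u (x i)) \<in> measurable (PiM I (\<lambda>_. M)) N"
  by (rule measurable_compose[OF measurable_component_singleton])

text \<open>The source of all expectations below: expanding both determinants into permutations turns the density
times \<open>\<Prod>i. f i (x i)\<close> into a combination of product functions, each integrated by Fubini.\<close>

lemma ensemble_integral_prod:
  fixes f :: "nat \<Rightarrow> real \<Rightarrow> 'b :: {real_normed_field, banach, second_countable_topology}"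
  assumes be: "biorthogonal_ensemble N M P Q" and N: "N \<ge> 1"
    and f: "\<And>i. i < N \<Longrightarrow> f i \<in> borel_measurable borel"
    and int: "\<And>i k m. i < N \<Longrightarrow> k < N \<Longrightarrow> m < N \<Longrightarrow> integrable M (\<lambda>x. (P k x * Q m x) *\<^sub>R f i x)"
  shows "integrable (ensemble_measure N M P Q) (\<lambda>x. \<Prod>i<N. f i (x i))"
    and "(\<integral>x. (\<Prod>i<N. f i (x i)) \<partial>ensemble_measure N M P Q) =
      (\<Sum>p | p permutes {..<N}. \<Sum>r | r permutes {..<N}. (of_int (sign p * sign r) / fact N) *\<^sub>R
          (\<Prod>i<N. \<integral>x. (P (p i) x * Q (r i) x) *\<^sub>R f i x \<partial>M))"
proof -
  let ?R = "PiM {..<N} (\<lambda>_. M)"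
  have sM: "sets M = sets borel"
    and PQ: "\<And>k. k < N \<Longrightarrow> P k \<in> borel_measurable M" "\<And>k. k < N \<Longrightarrow> Q k \<in> borel_measurable M"
    and nonneg: "AE x in ?R. 0 \<le> ensemble_density N P Q x"
    and prob: "prob_space (ensemble_measure N M P Q)"
    using be unfolding biorthogonal_ensemble_def square_integrable_def by auto
  have perm: "p i < N" if "p permutes {..<N}" "i < N" for p i
    using that permutes_in_image by fastforce
  have fM: "f i \<in> borel_measurable M" if "i < N" for i
    using f[OF that] by (simp only: measurable_cong_sets[OF sM refl])
  have Dm: "ensemble_density N P Q \<in> borel_measurable ?R"
    unfolding ensemble_density_permutation_sum[abs_def]
    by (intro borel_measurable_sum borel_measurable_times borel_measurable_const borel_measurable_prod measurable_PiM_coordinate PQ)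
       (simp_all add: perm)
  \<comment> \<open>The density has total mass 1, so the reference product measure cannot be the zero measure.\<close>
  have nonzero: "emeasure ?R (space ?R) \<noteq> 0"
  proof
    assume "emeasure ?R (space ?R) = 0"
    then have "AE x in ?R. False" by (intro AE_I'[of "space ?R"]) auto
    then have "AE x in ?R. ennreal (ensemble_density N P Q x) * indicator (space ?R) x = 0" by auto
    then have "emeasure (ensemble_measure N M P Q) (space ?R) = 0"
      unfolding ensemble_measure_def using Dm by (simp add: emeasure_density nn_integral_0_iff_AE)
    then show False using prob_space.emeasure_space_1[OF prob] by (simp add: ensemble_measure_def)
  qed
  define h where "h p r x = (\<Prod>i<N. (P (p i) (x i) * Q (r i) (x i)) *\<^sub>R f i (x i))" for p r x
  have h: "integrable ?R (h p r)"
    "(\<integral>x. h p r x \<partial>?R) = (\<Prod>i<N. \<integral>x. (P (p i) x * Q (r i) x) *\<^sub>R f i x \<partial>M)"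
    if "p permutes {..<N}" "r permutes {..<N}" for p r
  proof -
    have i: "integrable M (\<lambda>x. (P (p i) x * Q (r i) x) *\<^sub>R f i x)" if "i \<in> {..<N}" for i
      using that by (intro int perm[OF \<open>p permutes _\<close>] perm[OF \<open>r permutes _\<close>]) auto
    have "0 \<in> {..<N}" using N by simp
    then have ne: "{..<N} \<noteq> {}" by blast
    show "integrable ?R (h p r)"
      unfolding h_def by (rule integral_PiM_prod(1)[OF finite_lessThan ne nonzero i])
    show "(\<integral>x. h p r x \<partial>?R) = (\<Prod>i<N. \<integral>x. (P (p i) x * Q (r i) x) *\<^sub>R f i x \<partial>M)"
      unfolding h_def by (rule integral_PiM_prod(2)[OF finite_lessThan ne nonzero i])
  qed
  have Fm: "(\<lambda>x. \<Prod>i<N. f i (x i)) \<in> borel_measurable ?R"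
    by (intro borel_measurable_prod measurable_PiM_coordinate fM) auto
  have expand: "ensemble_density N P Q x *\<^sub>R (\<Prod>i<N. f i (x i)) =
      (\<Sum>p | p permutes {..<N}. \<Sum>r | r permutes {..<N}. (of_int (sign p * sign r) / fact N) *\<^sub>R h p r x)" for x
    unfolding ensemble_density_permutation_sum h_def
    by (simp add: sum_distrib_right sum_divide_distrib scaleR_conv_of_real prod.distrib mult.assoc)
  have int_expand: "integrable ?R (\<lambda>x. \<Sum>p | p permutes {..<N}. \<Sum>r | r permutes {..<N}.
      (of_int (sign p * sign r) / fact N) *\<^sub>R h p r x)"
    by (intro Bochner_Integration.integrable_sum integrable_scaleR_right h) auto
  show "integrable (ensemble_measure N M P Q) (\<lambda>x. \<Prod>i<N. f i (x i))"
    unfolding ensemble_measure_def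
    by (subst integrable_density[OF Fm Dm nonneg]) (use int_expand expand in simp)
  have "(\<integral>x. (\<Prod>i<N. f i (x i)) \<partial>ensemble_measure N M P Q) =
      (\<integral>x. (\<Sum>p | p permutes {..<N}. \<Sum>r | r permutes {..<N}.
        (of_int (sign p * sign r) / fact N) *\<^sub>R h p r x) \<partial>?R)"
    unfolding ensemble_measure_def by (subst integral_density[OF Fm Dm nonneg]) (simp only: expand)
  also have "\<dots> = (\<Sum>p | p permutes {..<N}. \<Sum>r | r permutes {..<N}.
        (of_int (sign p * sign r) / fact N) *\<^sub>R (\<integral>x. h p r x \<partial>?R))"
  proof -
    have "(\<integral>x. (\<Sum>p\<in>A. \<Sum>r\<in>A. c p r *\<^sub>R h p r x) \<partial>?R) = (\<Sum>p\<in>A. \<Sum>r\<in>A. c p r *\<^sub>R (\<integral>x. h p r x \<partial>?R))"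
      if "\<And>p r. p \<in> A \<Longrightarrow> r \<in> A \<Longrightarrow> integrable ?R (h p r)" for A and c :: "(nat \<Rightarrow> nat) \<Rightarrow> (nat \<Rightarrow> nat) \<Rightarrow> real"
    proof -
      have "(\<integral>x. (\<Sum>p\<in>A. \<Sum>r\<in>A. c p r *\<^sub>R h p r x) \<partial>?R) = (\<Sum>p\<in>A. \<integral>x. (\<Sum>r\<in>A. c p r *\<^sub>R h p r x) \<partial>?R)"
        by (intro Bochner_Integration.integral_sum Bochner_Integration.integrable_sum integrable_scaleR_right that)
      also have "\<dots> = (\<Sum>p\<in>A. \<Sum>r\<in>A. \<integral>x. c p r *\<^sub>R h p r x \<partial>?R)"
        by (intro sum.cong refl Bochner_Integration.integral_sum integrable_scaleR_right that)
      finally show ?thesis by simp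
    qed
    then show ?thesis by this (simp add: h(1))
  qed
  also have "\<dots> = (\<Sum>p | p permutes {..<N}. \<Sum>r | r permutes {..<N}. (of_int (sign p * sign r) / fact N) *\<^sub>R
          (\<Prod>i<N. \<integral>x. (P (p i) x * Q (r i) x) *\<^sub>R f i x \<partial>M))"
    by (intro sum.cong refl arg_cong2[where f="(*\<^sub>R)"] h) auto
  finally show "(\<integral>x. (\<Prod>i<N. f i (x i)) \<partial>ensemble_measure N M P Q) = \<dots>" .
qed

text \<open>When all \<open>f i\<close> coincide, the sum over the second permutation is a determinant with permuted rows. The
sign cancels, so every one of the \<open>N!\<close> first permutations contributes the same determinant.\<close>

lemma andreief_identity:
  fixes f :: "real \<Rightarrow> 'b :: {real_normed_field, banach, second_countable_topology}"
  assumes be: "biorthogonal_ensemble N M P Q" and N: "N \<ge> 1"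
    and f: "f \<in> borel_measurable borel"
    and int: "\<And>k m. k < N \<Longrightarrow> m < N \<Longrightarrow> integrable M (\<lambda>x. (P k x * Q m x) *\<^sub>R f x)"
  shows "(\<integral>x. (\<Prod>i<N. f (x i)) \<partial>ensemble_measure N M P Q) =
      Determinant.det (Matrix.mat N N (\<lambda>(k, m). \<integral>x. (P k x * Q m x) *\<^sub>R f x \<partial>M))"
proof -
  define G where "G k m = (\<integral>x. (P k x * Q m x) *\<^sub>R f x \<partial>M)" for k m
  let ?G = "Matrix.mat N N (\<lambda>(k, m). G k m)"
  have row: "(\<Sum>r | r permutes {..<N}. of_int (sign r) * (\<Prod>i<N. G (p i) (r i))) = of_int (sign p) * Determinant.det ?G"
    if p: "p permutes {..<N}" for p
  proof -
    have pl: "p i < N" if "i < N" for i using p that permutes_in_image by fastforce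
    have "of_int (sign p) * Determinant.det ?G = Determinant.det (Matrix.mat N N (\<lambda>(i, j). ?G $$ (p i, j)))"
      by (rule det_permute_rows[symmetric]) (use p in \<open>auto simp: atLeast0LessThan\<close>)
    also have "Matrix.mat N N (\<lambda>(i, j). ?G $$ (p i, j)) = Matrix.mat N N (\<lambda>(i, j). G (p i) j)"
      by (rule eq_matI) (auto simp: pl)
    finally show ?thesis by (simp only: det_mat_permutation_sum)
  qed
  have "(\<integral>x. (\<Prod>i<N. f (x i)) \<partial>ensemble_measure N M P Q) =
      (\<Sum>p | p permutes {..<N}. \<Sum>r | r permutes {..<N}. (of_int (sign p * sign r) / fact N) *\<^sub>R (\<Prod>i<N. G (p i) (r i)))"
    using ensemble_integral_prod(2)[OF be N, of "\<lambda>_. f"] f int by (simp add: G_def)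
  also have "\<dots> = (\<Sum>p | p permutes {..<N}. of_int (sign p) / fact N *
      (\<Sum>r | r permutes {..<N}. of_int (sign r) * (\<Prod>i<N. G (p i) (r i))))"
    by (simp add: sum_distrib_left scaleR_conv_of_real mult.assoc)
  also have "\<dots> = (\<Sum>p | p permutes {..<N}. Determinant.det ?G / fact N)"
    by (intro sum.cong refl) (simp add: row flip: mult.assoc of_int_mult)
  also have "\<dots> = Determinant.det ?G" by (simp add: card_permutations)
  finally show ?thesis by (simp add: G_def)
qed

lemma permutations_agreeing_off_pair:
  assumes p: "p permutes S" and r: "r permutes S"
    and off: "\<And>i. i \<in> S \<Longrightarrow> i \<noteq> a \<Longrightarrow> i \<noteq> b \<Longrightarrow> p i = r i"
  shows "r = p \<or> r = p \<circ> Transposition.transpose a b"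
proof -
  have bp: "bij p" using p by (rule permutes_bij)
  have "Hilbert_Choice.inv p \<circ> r permutes {a, b}"
  proof (rule permutes_superset)
    show "Hilbert_Choice.inv p \<circ> r permutes S" using permutes_compose[OF r permutes_inv[OF p]] .
    show "(Hilbert_Choice.inv p \<circ> r) x = x" if "x \<in> S - {a, b}" for x
      using that off[of x] bp by (simp add: bij_is_inj flip: off)
  qed
  then have "Hilbert_Choice.inv p \<circ> r = id \<or> Hilbert_Choice.inv p \<circ> r = Transposition.transpose a b"
    by (simp only: permutes_doubleton_iff)
  moreover have "r = p \<circ> (Hilbert_Choice.inv p \<circ> r)"
    using bp by (auto simp: fun_eq_iff bij_is_surj surj_f_inv_f)
  ultimately show ?thesis by (metis comp_id)
qed

text \<open>For \<open>i\<close> other than \<open>a\<close>, \<open>b\<close> the matrix \<open>F i\<close> is the identity, as biorthogonality provides for a test function that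
only depends on two coordinates. A permutation
\<open>r\<close> then contributes only if it agrees with \<open>p\<close> off \<open>a\<close>, \<open>b\<close>, which leaves \<open>p\<close> itself and its composition
with the transposition, of opposite sign.\<close>

lemma signed_sum_two_rows:
  fixes F :: "nat \<Rightarrow> nat \<Rightarrow> nat \<Rightarrow> 'b :: comm_ring_1"
  assumes ab: "a < N" "b < N" "a \<noteq> b" and p: "p permutes {..<N}"
    and F: "\<And>i k m. i < N \<Longrightarrow> i \<noteq> a \<Longrightarrow> i \<noteq> b \<Longrightarrow> k < N \<Longrightarrow> m < N \<Longrightarrow> F i k m = (if k = m then 1 else 0)"
  shows "(\<Sum>r | r permutes {..<N}. of_int (sign p * sign r) * (\<Prod>i<N. F i (p i) (r i)))
    = F a (p a) (p a) * F b (p b) (p b) - F a (p a) (p b) * F b (p b) (p a)"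
proof -
  let ?t = "Transposition.transpose a b"
  have lt: "s i < N" if "s permutes {..<N}" "i < N" for s i
    using that permutes_in_image by fastforce
  have t: "?t permutes {..<N}" using ab by (intro permutes_swap_id) auto
  have pt: "p \<circ> ?t permutes {..<N}" by (rule permutes_compose[OF t p])
  have inj: "p x = p y \<longleftrightarrow> x = y" for x y using permutes_inj[OF p] by (auto dest: injD)
  have ne: "p \<noteq> p \<circ> ?t"
  proof
    assume "p = p \<circ> ?t"
    then have "p a = (p \<circ> ?t) a" by (rule fun_cong)
    then show False using ab inj by simp
  qed
  have zero: "(\<Prod>i<N. F i (p i) (r i)) = 0" if r: "r permutes {..<N}" "r \<noteq> p" "r \<noteq> p \<circ> ?t" for r
  proof -
    obtain i where "i < N" "i \<noteq> a" "i \<noteq> b" "p i \<noteq> r i"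
      using permutations_agreeing_off_pair[OF p r(1), of a b] r by auto
    then show ?thesis using F[of i] lt[OF p] lt[OF r(1)]
      by (intro prod_zero bexI[of _ i]) auto
  qed
  have two: "(\<Prod>i<N. F i (p i) (r i)) = F a (p a) (r a) * F b (p b) (r b)"
    if r: "\<And>i. i \<noteq> a \<Longrightarrow> i \<noteq> b \<Longrightarrow> r i = p i" for r
  proof -
    have "(\<Prod>i<N. F i (p i) (r i)) = (\<Prod>i\<in>{a, b}. F i (p i) (r i))"
      by (rule prod.mono_neutral_right) (use ab F lt[OF p] r in auto)
    then show ?thesis using ab by simp
  qed
  have "(\<Sum>r | r permutes {..<N}. of_int (sign p * sign r) * (\<Prod>i<N. F i (p i) (r i)))
    = (\<Sum>r\<in>{p, p \<circ> ?t}. of_int (sign p * sign r) * (\<Prod>i<N. F i (p i) (r i)))"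
    by (rule sum.mono_neutral_right) (use p pt zero in \<open>auto simp: finite_permutations\<close>)
  also have "\<dots> = F a (p a) (p a) * F b (p b) (p b) + of_int (sign p * sign (p \<circ> ?t)) * (F a (p a) (p b) * F b (p b) (p a))"
    using ne two[of p] two[of "p \<circ> ?t"] by (simp add: transpose_apply_other del: of_int_mult)
  also have "sign p * sign (p \<circ> ?t) = - 1"
  proof -
    have "permutation p" "permutation ?t" using p t by (auto intro: permutation_permutes[THEN iffD2] finite_lessThan)
    then show ?thesis using ab by (simp add: sign_compose sign_swap_id)
  qed
  finally show ?thesis by simp
qed

lemma signed_sum_one_row:
  fixes F :: "nat \<Rightarrow> nat \<Rightarrow> nat \<Rightarrow> 'b :: comm_ring_1"
  assumes a: "a < N" and p: "p permutes {..<N}"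
    and F: "\<And>i k m. i < N \<Longrightarrow> i \<noteq> a \<Longrightarrow> k < N \<Longrightarrow> m < N \<Longrightarrow> F i k m = (if k = m then 1 else 0)"
  shows "(\<Sum>r | r permutes {..<N}. of_int (sign p * sign r) * (\<Prod>i<N. F i (p i) (r i))) = F a (p a) (p a)"
proof -
  have lt: "s i < N" if "s permutes {..<N}" "i < N" for s i
    using that permutes_in_image by fastforce
  have zero: "(\<Prod>i<N. F i (p i) (r i)) = 0" if r: "r permutes {..<N}" "r \<noteq> p" for r
  proof -
    obtain i where "i < N" "i \<noteq> a" "p i \<noteq> r i"
      using permutations_agreeing_off_pair[OF p r(1), of a a] r by auto
    then show ?thesis using F[of i] lt[OF p] lt[OF r(1)]
      by (intro prod_zero bexI[of _ i]) auto
  qed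
  have "(\<Sum>r | r permutes {..<N}. of_int (sign p * sign r) * (\<Prod>i<N. F i (p i) (r i)))
    = (\<Sum>r\<in>{p}. of_int (sign p * sign r) * (\<Prod>i<N. F i (p i) (r i)))"
    by (rule sum.mono_neutral_right) (use p zero in \<open>auto simp: finite_permutations\<close>)
  also have "\<dots> = (\<Prod>i<N. F i (p i) (p i))" by simp
  also have "\<dots> = (\<Prod>i\<in>{a}. F i (p i) (p i))"
    by (rule prod.mono_neutral_right) (use a F lt[OF p] in auto)
  finally show ?thesis by simp
qed

text \<open>Mean and second moment of a linear statistic \<open>\<Sum>i. g (x i)\<close>. The matrices \<open>G\<close> and \<open>H\<close> represent
multiplication by \<open>g\<close> and by \<open>g\<^sup>2\<close>; in general \<open>H\<close> differs from the square of the truncated matrix \<open>G\<close>, and the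
trace of this discrepancy is the variance.\<close>

context
  fixes N :: nat and M :: "real measure" and P Q :: "nat \<Rightarrow> real \<Rightarrow> real"
    and g :: "real \<Rightarrow> real" and G H :: "nat \<Rightarrow> nat \<Rightarrow> real"
  assumes be: "biorthogonal_ensemble N M P Q" and N: "N \<ge> 1"
    and g_meas: "g \<in> borel_measurable borel"
    and int0: "\<And>k m. k < N \<Longrightarrow> m < N \<Longrightarrow> integrable M (\<lambda>x. P k x * Q m x)"
    and int1: "\<And>k m. k < N \<Longrightarrow> m < N \<Longrightarrow> integrable M (\<lambda>x. P k x * Q m x * g x)"
    and int2: "\<And>k m. k < N \<Longrightarrow> m < N \<Longrightarrow> integrable M (\<lambda>x. P k x * Q m x * (g x)\<^sup>2)"
    and G: "\<And>k m. k < N \<Longrightarrow> m < N \<Longrightarrow> (LINT x|M. P k x * Q m x * g x) = G k m"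
    and H: "\<And>k m. k < N \<Longrightarrow> m < N \<Longrightarrow> (LINT x|M. P k x * Q m x * (g x)\<^sup>2) = H k m"
begin

private lemma inner: "k < N \<Longrightarrow> m < N \<Longrightarrow> (LINT x|M. P k x * Q m x) = (if k = m then 1 else 0)"
  using be by (simp add: biorthogonal_ensemble_def L2_inner_def)

private lemma perm_lt: "p permutes {..<N} \<Longrightarrow> i < N \<Longrightarrow> p i < N"
  using permutes_in_image by fastforce

private lemma one_point:
  assumes a: "a < N" and h: "h \<in> borel_measurable borel"
    and inth: "\<And>k m. k < N \<Longrightarrow> m < N \<Longrightarrow> integrable M (\<lambda>x. P k x * Q m x * h x)"
  shows "integrable (ensemble_measure N M P Q) (\<lambda>x. h (x a))"
    and "(\<integral>x. h (x a) \<partial>ensemble_measure N M P Q) =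
      (\<Sum>p | p permutes {..<N}. (LINT x|M. P (p a) x * Q (p a) x * h x)) / fact N"
proof -
  define f where "f i = (if i = a then h else (\<lambda>_. 1))" for i
  have f: "f i \<in> borel_measurable borel" for i using h by (simp add: f_def)
  have int: "integrable M (\<lambda>x. (P k x * Q m x) *\<^sub>R f i x)" if "k < N" "m < N" for i k m
    using inth int0 that by (simp add: f_def)
  have prod: "(\<Prod>i<N. f i (x i)) = h (x a)" for x :: "nat \<Rightarrow> real"
    using a by (simp add: f_def if_distrib[of "\<lambda>u. u _"] prod.delta' cong: if_cong)
  show "integrable (ensemble_measure N M P Q) (\<lambda>x. h (x a))"
    using ensemble_integral_prod(1)[where f = f, OF be N f int] by (simp only: prod)
  define F where "F i k m = (\<integral>x. (P k x * Q m x) *\<^sub>R f i x \<partial>M)" for i k m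
  have "(\<integral>x. h (x a) \<partial>ensemble_measure N M P Q) =
      (\<Sum>p | p permutes {..<N}. \<Sum>r | r permutes {..<N}. (of_int (sign p * sign r) / fact N) *\<^sub>R (\<Prod>i<N. F i (p i) (r i)))"
    unfolding F_def using ensemble_integral_prod(2)[where f = f, OF be N f int] by (simp only: prod)
  also have "\<dots> = (\<Sum>p | p permutes {..<N}. \<Sum>r | r permutes {..<N}. of_int (sign p * sign r) * (\<Prod>i<N. F i (p i) (r i))) / fact N"
    by (simp add: sum_divide_distrib)
  also have "\<dots> = (\<Sum>p | p permutes {..<N}. F a (p a) (p a)) / fact N"
    by (intro arg_cong2[where f="(/)"] sum.cong refl signed_sum_one_row a) (auto simp: F_def f_def inner)
  finally show "(\<integral>x. h (x a) \<partial>ensemble_measure N M P Q) =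
      (\<Sum>p | p permutes {..<N}. (LINT x|M. P (p a) x * Q (p a) x * h x)) / fact N"
    by (simp add: F_def f_def)
qed

private lemma two_point:
  assumes ab: "a < N" "b < N" "a \<noteq> b"
  shows "integrable (ensemble_measure N M P Q) (\<lambda>x. g (x a) * g (x b))"
    and "(\<integral>x. g (x a) * g (x b) \<partial>ensemble_measure N M P Q) =
      (\<Sum>p | p permutes {..<N}. G (p a) (p a) * G (p b) (p b) - G (p a) (p b) * G (p b) (p a)) / fact N"
proof -
  define f where "f i = (if i = a \<or> i = b then g else (\<lambda>_. 1))" for i
  have f: "f i \<in> borel_measurable borel" for i using g_meas by (simp add: f_def)
  have int: "integrable M (\<lambda>x. (P k x * Q m x) *\<^sub>R f i x)" if "k < N" "m < N" for i k m
    using int1 int0 that by (simp add: f_def)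
  have prod: "(\<Prod>i<N. f i (x i)) = g (x a) * g (x b)" for x :: "nat \<Rightarrow> real"
  proof -
    have "(\<Prod>i<N. f i (x i)) = (\<Prod>i\<in>{a, b}. f i (x i))"
      by (rule prod.mono_neutral_right) (use ab in \<open>auto simp: f_def\<close>)
    then show ?thesis using ab by (simp add: f_def)
  qed
  show "integrable (ensemble_measure N M P Q) (\<lambda>x. g (x a) * g (x b))"
    using ensemble_integral_prod(1)[where f = f, OF be N f int] by (simp only: prod)
  define F where "F i k m = (\<integral>x. (P k x * Q m x) *\<^sub>R f i x \<partial>M)" for i k m
  have "(\<integral>x. g (x a) * g (x b) \<partial>ensemble_measure N M P Q) =
      (\<Sum>p | p permutes {..<N}. \<Sum>r | r permutes {..<N}. (of_int (sign p * sign r) / fact N) *\<^sub>R (\<Prod>i<N. F i (p i) (r i)))"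
    unfolding F_def using ensemble_integral_prod(2)[where f = f, OF be N f int] by (simp only: prod)
  also have "\<dots> = (\<Sum>p | p permutes {..<N}. \<Sum>r | r permutes {..<N}. of_int (sign p * sign r) * (\<Prod>i<N. F i (p i) (r i))) / fact N"
    by (simp add: sum_divide_distrib)
  also have "\<dots> = (\<Sum>p | p permutes {..<N}. F a (p a) (p a) * F b (p b) (p b) - F a (p a) (p b) * F b (p b) (p a)) / fact N"
    by (intro arg_cong2[where f="(/)"] sum.cong refl signed_sum_two_rows ab) (auto simp: F_def f_def inner)
  also have "\<dots> = (\<Sum>p | p permutes {..<N}. G (p a) (p a) * G (p b) (p b) - G (p a) (p b) * G (p b) (p a)) / fact N"
    using ab by (intro arg_cong2[where f="(/)"] sum.cong refl) (simp add: F_def f_def G perm_lt)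
  finally show "(\<integral>x. g (x a) * g (x b) \<partial>ensemble_measure N M P Q) = \<dots>" .
qed

lemma linear_statistic_mean:
  shows "integrable (ensemble_measure N M P Q) (\<lambda>x. \<Sum>i<N. g (x i))"
    and "(\<integral>x. (\<Sum>i<N. g (x i)) \<partial>ensemble_measure N M P Q) = (\<Sum>k<N. G k k)"
proof -
  note op = one_point[OF _ g_meas int1]
  show "integrable (ensemble_measure N M P Q) (\<lambda>x. \<Sum>i<N. g (x i))"
    using op(1) by (intro Bochner_Integration.integrable_sum) auto
  have "(\<integral>x. (\<Sum>i<N. g (x i)) \<partial>ensemble_measure N M P Q) =
      (\<Sum>i<N. \<integral>x. g (x i) \<partial>ensemble_measure N M P Q)"
    using op(1) by (intro Bochner_Integration.integral_sum) auto
  also have "\<dots> = (\<Sum>i<N. (\<Sum>p | p permutes {..<N}. G (p i) (p i)) / fact N)"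
    by (intro sum.cong refl) (simp add: op(2) G perm_lt)
  also have "\<dots> = (\<Sum>p | p permutes {..<N}. \<Sum>i<N. G (p i) (p i)) / fact N"
    by (subst sum.swap) (simp add: sum_divide_distrib)
  \<comment> \<open>Summed over all points, the average over permutations is constant in the permutation.\<close>
  also have "\<dots> = (\<Sum>p | p permutes {..<N}. \<Sum>k<N. G k k) / fact N"
    by (intro arg_cong2[where f="(/)"] sum.cong refl sum.permute[of _ _ "\<lambda>k. G k k", unfolded comp_def, symmetric]) simp
  finally show "(\<integral>x. (\<Sum>i<N. g (x i)) \<partial>ensemble_measure N M P Q) = (\<Sum>k<N. G k k)"
    by (simp add: card_permutations)
qed

text \<open>A diagonal pair \<open>a = b\<close> is a one-point function of \<open>g\<^sup>2\<close>, an off-diagonal pair gives a \<open>2 \<times> 2\<close> minor. The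
minors with equal indices vanish, so they may be included in the sum.\<close>

lemma linear_statistic_second_moment:
  shows "integrable (ensemble_measure N M P Q) (\<lambda>x. (\<Sum>i<N. g (x i))\<^sup>2)"
    and "(\<integral>x. (\<Sum>i<N. g (x i))\<^sup>2 \<partial>ensemble_measure N M P Q) =
      (\<Sum>k<N. G k k)\<^sup>2 + (\<Sum>k<N. H k k - (\<Sum>m<N. G k m * G m k))"
proof -
  let ?E = "ensemble_measure N M P Q"
  have g2: "(\<lambda>x. (g x)\<^sup>2) \<in> borel_measurable borel" using g_meas by measurable
  note op = one_point[OF _ g2 int2]
  define D where "D k m = (if k = m then H k k else G k k * G m m - G k m * G m k)" for k m
  have pair: "integrable ?E (\<lambda>x. g (x a) * g (x b))"
    "(\<integral>x. g (x a) * g (x b) \<partial>?E) = (\<Sum>p | p permutes {..<N}. D (p a) (p b)) / fact N"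
    if "a < N" "b < N" for a b
  proof -
    have inj: "p a = p b \<longleftrightarrow> a = b" if "p permutes {..<N}" for p
      using permutes_inj[OF that] by (auto dest: injD)
    show "integrable ?E (\<lambda>x. g (x a) * g (x b))"
      using op(1) two_point(1) that by (cases "a = b") (auto simp: power2_eq_square)
    show "(\<integral>x. g (x a) * g (x b) \<partial>?E) = (\<Sum>p | p permutes {..<N}. D (p a) (p b)) / fact N"
    proof (cases "a = b")
      case True
      then have "(\<integral>x. g (x a) * g (x b) \<partial>?E) = (\<integral>x. (g (x a))\<^sup>2 \<partial>?E)"
        by (simp add: power2_eq_square)
      also have "\<dots> = (\<Sum>p | p permutes {..<N}. (LINT x|M. P (p a) x * Q (p a) x * (g x)\<^sup>2)) / fact N"
        by (rule op(2)[OF that(1)])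
      also have "\<dots> = (\<Sum>p | p permutes {..<N}. D (p a) (p b)) / fact N"
        using that True
        by (intro arg_cong2[where f="(/)"] sum.cong refl) (simp add: D_def H perm_lt)
      finally show ?thesis .
    next
      case False
      then show ?thesis unfolding two_point(2)[OF that False]
        by (intro arg_cong2[where f="(/)"] sum.cong refl) (simp add: D_def inj)
    qed
  qed
  have sq: "(\<Sum>i<N. g (x i))\<^sup>2 = (\<Sum>a<N. \<Sum>b<N. g (x a) * g (x b))" for x :: "nat \<Rightarrow> real"
    by (simp add: power2_eq_square sum_product)
  show "integrable ?E (\<lambda>x. (\<Sum>i<N. g (x i))\<^sup>2)"
    unfolding sq using pair(1) by (intro Bochner_Integration.integrable_sum) auto
  have "(\<integral>x. (\<Sum>i<N. g (x i))\<^sup>2 \<partial>?E) = (\<Sum>a<N. \<integral>x. (\<Sum>b<N. g (x a) * g (x b)) \<partial>?E)"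
    unfolding sq using pair(1)
    by (intro Bochner_Integration.integral_sum Bochner_Integration.integrable_sum) auto
  also have "\<dots> = (\<Sum>a<N. \<Sum>b<N. \<integral>x. g (x a) * g (x b) \<partial>?E)"
    using pair(1) by (intro sum.cong refl Bochner_Integration.integral_sum) auto
  also have "\<dots> = (\<Sum>a<N. \<Sum>b<N. (\<Sum>p | p permutes {..<N}. D (p a) (p b)) / fact N)"
    by (intro sum.cong refl) (simp add: pair(2))
  also have "\<dots> = (\<Sum>p | p permutes {..<N}. \<Sum>a<N. \<Sum>b<N. D (p a) (p b)) / fact N"
    by (simp only: sum_divide_distrib[symmetric] sum.swap[of _ "{..<N}" "{p. p permutes {..<N}}"])
  also have "\<dots> = (\<Sum>p | p permutes {..<N}. \<Sum>a<N. \<Sum>b<N. D a b) / fact N"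
  proof -
    have "(\<Sum>a<N. \<Sum>b<N. D (p a) (p b)) = (\<Sum>a<N. \<Sum>b<N. D a b)" if p: "p permutes {..<N}" for p
    proof -
      have "(\<Sum>a<N. \<Sum>b<N. D (p a) (p b)) = (\<Sum>a<N. \<Sum>b<N. D (p a) b)"
        by (intro sum.cong refl sum.permute[OF p, unfolded comp_def, symmetric])
      also have "\<dots> = (\<Sum>a<N. \<Sum>b<N. D a b)"
        by (rule sum.permute[OF p, of "\<lambda>a. \<Sum>b<N. D a b", unfolded comp_def, symmetric])
      finally show ?thesis .
    qed
    then show ?thesis by simp
  qed
  also have "\<dots> = (\<Sum>a<N. \<Sum>b<N. D a b)" by (simp add: card_permutations)
  also have "\<dots> = (\<Sum>a<N. \<Sum>b<N. G a a * G b b - G a b * G b a + (if a = b then H a a else 0))"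
    by (intro sum.cong refl) (simp add: D_def)
  also have "\<dots> = (\<Sum>k<N. G k k)\<^sup>2 + (\<Sum>k<N. H k k - (\<Sum>m<N. G k m * G m k))"
    by (simp add: sum.distrib sum_subtractf power2_eq_square sum_product sum.delta)
  finally show "(\<integral>x. (\<Sum>i<N. g (x i))\<^sup>2 \<partial>?E) = \<dots>" .
qed

end

section \<open>Powers of banded matrices near the truncation level\<close>

text \<open>The entries of the \<open>l\<close>-th power of the \<open>B \<times> B\<close> corner of an infinite matrix. As a recursive function it
avoids the side conditions on indices that entries of matrices carry, and different truncation levels
can be compared.\<close>

primrec truncated_power :: "(nat \<Rightarrow> nat \<Rightarrow> real) \<Rightarrow> nat \<Rightarrow> nat \<Rightarrow> nat \<Rightarrow> nat \<Rightarrow> real" where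
  "truncated_power A B 0 k m = (if k = m then 1 else 0)"
| "truncated_power A B (Suc l) k m = (\<Sum>j<B. truncated_power A B l k j * A j m)"

lemma truncated_power_eq_mat_power:
  assumes "k < B" "m < B"
  shows "(Matrix.mat B B (\<lambda>(i, j). A i j) ^\<^sub>m l) $$ (k, m) = truncated_power A B l k m"
  using assms
proof (induction l arbitrary: m)
  case 0
  then show ?case by simp
next
  case (Suc l)
  let ?T = "Matrix.mat B B (\<lambda>(i, j). A i j)"
  have c: "?T ^\<^sub>m l \<in> carrier_mat B B" by (simp add: pow_carrier_mat)
  have "(?T ^\<^sub>m Suc l) $$ (k, m) = (\<Sum>j = 0..<B. (?T ^\<^sub>m l) $$ (k, j) * ?T $$ (j, m))"
    using Suc.prems c by (simp add: times_mat_def scalar_prod_def)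
  also have "\<dots> = (\<Sum>j = 0..<B. truncated_power A B l k j * A j m)"
    using Suc by (intro sum.cong refl) simp
  finally show ?case by (simp add: atLeast0LessThan)
qed

lemma truncated_power_banded:
  assumes band: "\<And>k j. k + q < j \<Longrightarrow> A k j = 0" and "k + l * q < m"
  shows "truncated_power A B l k m = 0"
  using assms(2)
proof (induction l arbitrary: m)
  case (Suc l)
  have "truncated_power A B l k j * A j m = 0" for j
  proof (cases "k + l * q < j")
    case False
    then have "j + q < m" using Suc.prems by simp
    then show ?thesis by (simp add: band)
  qed (simp add: Suc.IH)
  then show ?case by (simp only: truncated_power.simps) (simp only: sum.neutral_const)
qed simp

text \<open>The reason why only entries near the diagonal matter. The target \<open>m\<close> lies at least \<open>l * q\<close> above \<open>L\<close>; as each step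
climbs by at most \<open>q\<close>, a walk of length \<open>l\<close> that reaches \<open>m\<close> can never have been below \<open>L\<close>. Nor can it
exceed \<open>k + l * q \<le> U\<close>. So at each step there are at most \<open>U + 1 - L\<close> choices, each of weight at most \<open>C\<close>.\<close>

lemma truncated_power_bound:
  assumes band: "\<And>k j. k + q < j \<Longrightarrow> A k j = 0"
    and bound: "\<And>i j. L \<le> i \<Longrightarrow> i \<le> U \<Longrightarrow> L \<le> j \<Longrightarrow> j \<le> U \<Longrightarrow> \<bar>A i j\<bar> \<le> C"
    and C: "C \<ge> 0" and "k + l * q \<le> U" "L + l * q \<le> m"
  shows "\<bar>truncated_power A B l k m\<bar> \<le> (real (U + 1 - L) * C) ^ l"
  using assms(4,5)
proof (induction l arbitrary: m)
  case (Suc l)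
  let ?b = "(real (U + 1 - L) * C) ^ l"
  let ?t = "\<lambda>j. truncated_power A B l k j * A j m"
  have b: "?b \<ge> 0" using C by simp
  have kU: "k + l * q \<le> U" using Suc.prems by simp
  have out: "?t j = 0" if "j \<notin> {L..U}" for j
  proof (cases "k + l * q < j")
    case True
    then show ?thesis by (simp add: truncated_power_banded[of q] band)
  next
    case False
    then have "j < L" using that kU by auto
    then have "j + q < m" using Suc.prems by simp
    then show ?thesis by (simp add: band)
  qed
  have inside: "\<bar>?t j\<bar> \<le> ?b * C" if j: "j \<in> {L..U}" for j
  proof (cases "k + l * q < j \<or> j + q < m")
    case True
    then have "?t j = 0" by (auto simp: truncated_power_banded[of q] band)
    then have "\<bar>?t j\<bar> = 0" by simp
    then show ?thesis using mult_nonneg_nonneg[OF b C] by linarith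
  next
    case False
    then have "L + l * q \<le> j" "L \<le> m" "m \<le> U" using Suc.prems by auto
    then have "\<bar>truncated_power A B l k j\<bar> \<le> ?b" "\<bar>A j m\<bar> \<le> C"
      using Suc.IH[OF kU] bound j by auto
    then show ?thesis using b by (auto simp: abs_mult intro: mult_mono)
  qed
  have "\<bar>truncated_power A B (Suc l) k m\<bar> \<le> (\<Sum>j<B. \<bar>?t j\<bar>)" by simp
  also have "\<dots> = (\<Sum>j\<in>{..<B} \<inter> {L..U}. \<bar>?t j\<bar>)"
    by (rule sum.mono_neutral_right) (use out in auto)
  also have "\<dots> \<le> (\<Sum>j\<in>{L..U}. \<bar>?t j\<bar>)"
    by (rule sum_mono2) auto
  also have "\<dots> \<le> (\<Sum>j\<in>{L..U}. ?b * C)" by (rule sum_mono) (rule inside)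
  also have "\<dots> = (real (U + 1 - L) * C) ^ Suc l" by (simp del: of_nat_diff of_nat_Suc)
  finally show ?case .
qed simp

text \<open>\<open>G l\<close> is to be read as the \<open>l\<close>-th power of the infinite banded matrix \<open>G 1\<close>. The band condition makes
each matrix product a finite sum.\<close>

locale banded_semigroup =
  fixes G :: "nat \<Rightarrow> nat \<Rightarrow> nat \<Rightarrow> real" and q :: nat
  assumes unit: "G 0 k m = (if k = m then 1 else 0)"
    and semigroup: "G (a + b) k m = (\<Sum>j\<le>k + a * q. G a k j * G b j m)"
    and band: "k + l * q < m \<Longrightarrow> G l k m = 0"
begin

abbreviation tpow :: "nat \<Rightarrow> nat \<Rightarrow> nat \<Rightarrow> nat \<Rightarrow> real" where
  "tpow \<equiv> truncated_power (G 1)"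

lemma band1: "k + q < m \<Longrightarrow> G 1 k m = 0"
  using band[of k 1 m] by simp

text \<open>Walks of length \<open>l\<close> from \<open>k\<close> stay below \<open>k + l * q + 1\<close>, so they do not see a truncation above that level.\<close>

lemma eq_truncated_power:
  assumes "k + l * q < B"
  shows "G l k m = tpow B l k m"
  using assms
proof (induction l arbitrary: m)
  case 0
  then show ?case by (simp add: unit)
next
  case (Suc l)
  then have B: "k + l * q < B" by simp
  have "G (l + 1) k m = (\<Sum>j\<le>k + l * q. G l k j * G 1 j m)" by (rule semigroup)
  also have "\<dots> = (\<Sum>j<B. G l k j * G 1 j m)"
    by (rule sum.mono_neutral_left) (use B band in auto)
  also have "\<dots> = tpow B (Suc l) k m" using Suc.IH[OF B] by simp
  finally show ?case by simp
qed

lemma entry_bound: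
  assumes bd: "\<And>i j. L \<le> i \<Longrightarrow> i \<le> U \<Longrightarrow> L \<le> j \<Longrightarrow> j \<le> U \<Longrightarrow> \<bar>G 1 i j\<bar> \<le> C"
    and "C \<ge> 0" "k + l * q \<le> U" "L + l * q \<le> m"
  shows "\<bar>G l k m\<bar> \<le> (real (U + 1 - L) * C) ^ l"
proof -
  have "G l k m = tpow (Suc (k + l * q)) l k m" by (rule eq_truncated_power) simp
  then show ?thesis using truncated_power_bound[where A = "G 1", OF band1 bd assms(2-4)] by (simp only:)
qed

text \<open>Comparison of the infinite matrix with its \<open>N \<times> N\<close> corner. The window of radius \<open>2 * l * q\<close> around \<open>N\<close>
contains every closed walk of length \<open>l\<close> that starts within \<open>l * q\<close> of \<open>N\<close>.\<close>

context
  fixes N l :: nat and C :: real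
  assumes big: "2 * l * q \<le> N" and C: "C \<ge> 0"
    and coeff: "\<And>i j. N - 2 * l * q \<le> i \<Longrightarrow> i \<le> N + 2 * l * q \<Longrightarrow>
        N - 2 * l * q \<le> j \<Longrightarrow> j \<le> N + 2 * l * q \<Longrightarrow> \<bar>G 1 i j\<bar> \<le> C"
begin

private lemma width: "real (N + 2 * l * q + 1 - (N - 2 * l * q)) = 4 * real l * real q + 1"
  using big by (simp add: of_nat_diff)

private lemma near_bound:
  assumes "N \<le> k + l * q" "k \<le> N + l * q" "N \<le> m + l * q" "m \<le> N + l * q"
  shows "\<bar>G l k m\<bar> \<le> ((4 * real l * real q + 1) * C) ^ l"
    and "\<bar>tpow B l k m\<bar> \<le> ((4 * real l * real q + 1) * C) ^ l"
proof -
  have range: "k + l * q \<le> N + 2 * l * q" "N - 2 * l * q + l * q \<le> m"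
    using assms big by simp_all
  show "\<bar>G l k m\<bar> \<le> ((4 * real l * real q + 1) * C) ^ l"
    by (rule entry_bound[where L = "N - 2 * l * q" and U = "N + 2 * l * q", OF coeff C range, unfolded width])
  show "\<bar>tpow B l k m\<bar> \<le> ((4 * real l * real q + 1) * C) ^ l"
    by (rule truncated_power_bound[where A = "G 1" and L = "N - 2 * l * q" and U = "N + 2 * l * q",
          OF band1 coeff C range, unfolded width])
qed

text \<open>For \<open>k < N - l * q\<close> the truncation is invisible and the diagonal entries agree; at most \<open>l * q\<close> of them
remain, and each is bounded by the walk estimate.\<close>

lemma trace_power_difference:
  "\<bar>(\<Sum>k<N. G l k k) - (\<Sum>k<N. tpow N l k k)\<bar> \<le>
     2 * (real l * real q) * ((4 * real l * real q + 1) * C) ^ l"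
proof -
  let ?b = "((4 * real l * real q + 1) * C) ^ l"
  have lq: "l * q \<le> N" using big by simp
  have "(\<Sum>k<N. G l k k) - (\<Sum>k<N. tpow N l k k) = (\<Sum>k<N. G l k k - tpow N l k k)"
    by (simp add: sum_subtractf)
  also have "\<dots> = (\<Sum>k\<in>{N - l * q..<N}. G l k k - tpow N l k k)"
    by (rule sum.mono_neutral_right) (auto simp: eq_truncated_power[of _ l N])
  also have "\<bar>\<dots>\<bar> \<le> (\<Sum>k\<in>{N - l * q..<N}. 2 * ?b)"
  proof (rule order_trans[OF sum_abs sum_mono])
    fix k assume "k \<in> {N - l * q..<N}"
    then have "\<bar>G l k k\<bar> \<le> ?b" "\<bar>tpow N l k k\<bar> \<le> ?b" using near_bound[of k k] by auto
    then show "\<bar>G l k k - tpow N l k k\<bar> \<le> 2 * ?b" by linarith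
  qed
  also have "\<dots> = 2 * (real l * real q) * ?b" using lq by simp
  finally show ?thesis .
qed

text \<open>Writing \<open>G (l + l)\<close> as a product cancels all intermediate indices \<open>m < N\<close>. What is left are pairs
\<open>k < N \<le> m \<le> k + l * q\<close>, of which there are at most \<open>(l * q)\<^sup>2\<close>.\<close>

lemma variance_sum_bound:
  "\<bar>\<Sum>k<N. G (l + l) k k - (\<Sum>m<N. G l k m * G l m k)\<bar> \<le>
     (real l * real q)\<^sup>2 * (((4 * real l * real q + 1) * C) ^ l)\<^sup>2"
proof -
  let ?b = "((4 * real l * real q + 1) * C) ^ l"
  have lq: "l * q \<le> N" using big by simp
  have b: "?b \<ge> 0" using C by simp
  have outside: "G (l + l) k k - (\<Sum>m<N. G l k m * G l m k) = (\<Sum>j\<in>{N..k + l * q}. G l k j * G l j k)"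
    if "k < N" for k
  proof -
    have "G (l + l) k k = (\<Sum>j\<le>k + l * q. G l k j * G l j k)" by (rule semigroup)
    also have "\<dots> = (\<Sum>j\<in>{..<N} \<union> {N..k + l * q}. G l k j * G l j k)"
      by (rule sum.mono_neutral_left) (auto simp: band)
    also have "\<dots> = (\<Sum>j<N. G l k j * G l j k) + (\<Sum>j\<in>{N..k + l * q}. G l k j * G l j k)"
      by (rule sum.union_disjoint) auto
    finally show ?thesis by simp
  qed
  have "(\<Sum>k<N. G (l + l) k k - (\<Sum>m<N. G l k m * G l m k)) =
      (\<Sum>k<N. \<Sum>j\<in>{N..k + l * q}. G l k j * G l j k)"
    by (intro sum.cong refl outside) simp
  also have "\<dots> = (\<Sum>k\<in>{N - l * q..<N}. \<Sum>j\<in>{N..k + l * q}. G l k j * G l j k)"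
    by (rule sum.mono_neutral_right) (auto intro!: sum.neutral)
  also have "\<bar>\<dots>\<bar> \<le> (\<Sum>k\<in>{N - l * q..<N}. real l * real q * ?b\<^sup>2)"
  proof (rule order_trans[OF sum_abs sum_mono])
    fix k assume k: "k \<in> {N - l * q..<N}"
    have "\<bar>\<Sum>j\<in>{N..k + l * q}. G l k j * G l j k\<bar> \<le> (\<Sum>j\<in>{N..k + l * q}. ?b\<^sup>2)"
    proof (rule order_trans[OF sum_abs sum_mono])
      fix j assume "j \<in> {N..k + l * q}"
      then have "\<bar>G l k j\<bar> \<le> ?b" "\<bar>G l j k\<bar> \<le> ?b"
        using k near_bound(1)[of k j] near_bound(1)[of j k] by auto
      then show "\<bar>G l k j * G l j k\<bar> \<le> ?b\<^sup>2"
        using b unfolding abs_mult power2_eq_square by (intro mult_mono) auto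
    qed
    also have "\<dots> = real (k + l * q + 1 - N) * ?b\<^sup>2" by simp
    also have "\<dots> \<le> real (l * q) * ?b\<^sup>2"
      using k by (intro mult_right_mono) (auto simp del: of_nat_mult)
    finally show "\<bar>\<Sum>j\<in>{N..k + l * q}. G l k j * G l j k\<bar> \<le> real l * real q * ?b\<^sup>2" by simp
  qed
  also have "\<dots> = (real l * real q)\<^sup>2 * ?b\<^sup>2" using lq by (simp add: power2_eq_square)
  finally show ?thesis .
qed

end

end

section \<open>Power sums of the zeros of the average characteristic polynomial\<close>

lemma sum_count_times:
  fixes f :: "'a \<Rightarrow> 'b :: comm_semiring_1"
  assumes "finite S" "set_mset M \<subseteq> S"
  shows "(\<Sum>a\<in>S. of_nat (count M a) * f a) = (\<Sum>a\<in>#M. f a)"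
  using assms(2)
proof (induction M)
  case (add x M)
  have "(\<Sum>a\<in>S. of_nat (count (add_mset x M) a) * f a) =
      (\<Sum>a\<in>S. of_nat (count M a) * f a + (if a = x then f a else 0))"
    by (intro sum.cong refl) (auto simp: algebra_simps)
  also have "\<dots> = (\<Sum>a\<in>S. of_nat (count M a) * f a) + f x"
    using add.prems assms(1) by (simp add: sum.distrib sum.delta)
  finally show ?case using add by (simp add: add.commute)
qed simp

lemma expectation_pmf_of_multiset:
  fixes f :: "'a \<Rightarrow> complex"
  assumes "M \<noteq> {#}"
  shows "measure_pmf.expectation (pmf_of_multiset M) f = (\<Sum>a\<in>#M. f a) / of_nat (size M)"
proof -
  have "measure_pmf.expectation (pmf_of_multiset M) f = (\<Sum>a\<in>set_mset M. pmf (pmf_of_multiset M) a *\<^sub>R f a)"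
    by (rule integral_measure_pmf) (use assms in auto)
  also have "\<dots> = (\<Sum>a\<in>set_mset M. of_nat (count M a) * f a) / of_nat (size M)"
    using assms by (simp add: sum_divide_distrib scaleR_conv_of_real)
  finally show ?thesis by (simp add: sum_count_times)
qed

lemma trace_mult_commute:
  fixes X Y :: "'a :: comm_semiring_0 mat"
  assumes "X \<in> carrier_mat n n" "Y \<in> carrier_mat n n"
  shows "(\<Sum>i<n. (X * Y) $$ (i, i)) = (\<Sum>i<n. (Y * X) $$ (i, i))"
proof -
  have e: "(X * Y) $$ (i, i) = (\<Sum>j<n. X $$ (i, j) * Y $$ (j, i))"
    if "i < n" "X \<in> carrier_mat n n" "Y \<in> carrier_mat n n" for i and X Y :: "'a mat"
    using that by (simp add: times_mat_def scalar_prod_def atLeast0LessThan)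
  have "(\<Sum>i<n. (X * Y) $$ (i, i)) = (\<Sum>i<n. \<Sum>j<n. X $$ (i, j) * Y $$ (j, i))"
    using assms by (intro sum.cong refl e) auto
  also have "\<dots> = (\<Sum>j<n. \<Sum>i<n. Y $$ (j, i) * X $$ (i, j))"
    by (subst sum.swap) (simp add: mult.commute)
  also have "\<dots> = (\<Sum>i<n. (Y * X) $$ (i, i))"
    using assms by (intro sum.cong refl e[symmetric]) auto
  finally show ?thesis .
qed

lemma upper_triangular_power:
  fixes B :: "'a :: comm_semiring_1 mat"
  assumes B: "B \<in> carrier_mat n n" and ut: "upper_triangular B"
  shows "j < i \<Longrightarrow> i < n \<Longrightarrow> (B ^\<^sub>m l) $$ (i, j) = 0"
    and "i < n \<Longrightarrow> (B ^\<^sub>m l) $$ (i, i) = (B $$ (i, i)) ^ l"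
proof (induction l arbitrary: i j)
  case (Suc l)
  have c: "B ^\<^sub>m l \<in> carrier_mat n n" using B by (rule pow_carrier_mat)
  have step: "(B ^\<^sub>m Suc l) $$ (i, j) = (\<Sum>k<n. (B ^\<^sub>m l) $$ (i, k) * B $$ (k, j))" if "i < n" "j < n" for i j
    using that B c by (simp add: times_mat_def scalar_prod_def atLeast0LessThan)
  have B0: "B $$ (k, j) = 0" if "j < k" "k < n" for k j using ut B that by (auto simp: upper_triangular_def)
  {
    case 1
    have "(B ^\<^sub>m l) $$ (i, k) * B $$ (k, j) = 0" if "k < n" for k
      using 1 that Suc.IH(1)[of k i] B0[of j k] by (cases "k < i") auto
    then show ?case using 1 by (subst step) (auto intro: sum.neutral)
  next
    case 2
    have "(\<Sum>k<n. (B ^\<^sub>m l) $$ (i, k) * B $$ (k, i)) = (\<Sum>k\<in>{i}. (B ^\<^sub>m l) $$ (i, k) * B $$ (k, i))"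
    proof (rule sum.mono_neutral_right)
      show "\<forall>k\<in>{..<n} - {i}. (B ^\<^sub>m l) $$ (i, k) * B $$ (k, i) = 0"
      proof
        fix k assume k: "k \<in> {..<n} - {i}"
        then show "(B ^\<^sub>m l) $$ (i, k) * B $$ (k, i) = 0"
          using 2 Suc.IH(1)[of k i] B0[of i k] by (cases "k < i") auto
      qed
    qed (use 2 in auto)
    then show ?case using 2 Suc.IH(2)[of i] by (subst step) (simp_all add: mult.commute)
  }
qed (use B in auto)

text \<open>By Schur's theorem the matrix is similar to an upper triangular one, whose diagonal lists the roots; powers
act on the diagonal entrywise, and the trace is invariant under similarity.\<close>

lemma power_sum_roots_char_poly:
  fixes A :: "complex mat"
  assumes A: "A \<in> carrier_mat n n"
  shows "(\<Sum>z\<in>#proots (char_poly A). z ^ l) = (\<Sum>i<n. (A ^\<^sub>m l) $$ (i, i))"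
    and "size (proots (char_poly A)) = n"
proof -
  obtain as where "char_poly A = (\<Prod>a\<leftarrow>as. [:- a, 1:])"
    using char_poly_factorized[OF A] by blast
  then obtain B where B: "B \<in> carrier_mat n n" "upper_triangular B" and sim: "similar_mat A B"
    using schur_decomposition_exists[OF A] by blast
  then obtain P R where wit: "similar_mat_wit A B P R" by (auto simp: similar_mat_def)
  have PR: "R * P = 1\<^sub>m n" "P \<in> carrier_mat n n" "R \<in> carrier_mat n n"
    using similar_mat_witD2[OF A wit] by auto
  have pw: "A ^\<^sub>m l = P * B ^\<^sub>m l * R"
    using similar_mat_witD(3)[OF refl similar_mat_wit_pow[OF wit]] .
  have Bl: "B ^\<^sub>m l \<in> carrier_mat n n" using B by simp
  have "proots (char_poly A) = proots (\<Prod>p\<leftarrow>map (\<lambda>a. [:- a, 1:]) (diag_mat B). p)"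
    using char_poly_similar[OF sim] char_poly_upper_triangular[OF B] by simp
  also have "\<dots> = (\<Sum>p\<leftarrow>map (\<lambda>a. [:- a, 1:]) (diag_mat B). proots p)"
    by (rule proots_prod_list) auto
  also have "\<dots> = mset (diag_mat B)"
  proof -
    have "(\<Sum>a\<leftarrow>xs. {#a#}) = mset xs" for xs :: "complex list" by (induction xs) auto
    then show ?thesis by (simp add: comp_def)
  qed
  finally have roots: "proots (char_poly A) = mset (diag_mat B)" .
  show "size (proots (char_poly A)) = n" using B by (simp add: roots diag_mat_def)
  have "(\<Sum>z\<in>#proots (char_poly A). z ^ l) = (\<Sum>i<n. (B $$ (i, i)) ^ l)"
    using B by (simp add: roots diag_mat_def comp_def interv_sum_list_conv_sum_set_nat atLeast0LessThan sum_mset_sum_list flip: mset_map)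
  also have "\<dots> = (\<Sum>i<n. (B ^\<^sub>m l) $$ (i, i))"
    using B by (intro sum.cong refl) (simp add: upper_triangular_power(2))
  also have "B ^\<^sub>m l = B ^\<^sub>m l * (R * P)" by (simp add: PR(1) right_mult_one_mat[OF Bl])
  also have "\<dots> = B ^\<^sub>m l * R * P" using PR Bl by (simp add: assoc_mult_mat)
  also have "(\<Sum>i<n. (B ^\<^sub>m l * R * P) $$ (i, i)) = (\<Sum>i<n. (P * (B ^\<^sub>m l * R)) $$ (i, i))"
    by (rule trace_mult_commute) (use PR Bl in auto)
  also have "P * (B ^\<^sub>m l * R) = A ^\<^sub>m l" unfolding pw using PR Bl by (simp add: assoc_mult_mat)
  finally show "(\<Sum>z\<in>#proots (char_poly A). z ^ l) = (\<Sum>i<n. (A ^\<^sub>m l) $$ (i, i))" .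
qed

text \<open>Here \<open>A\<close> is the \<open>N \<times> N\<close> matrix of multiplication by \<open>x\<close>.\<close>

context
  fixes N :: nat and M :: "real measure" and P Q :: "nat \<Rightarrow> real \<Rightarrow> real" and A :: "nat \<Rightarrow> nat \<Rightarrow> real"
  assumes be: "biorthogonal_ensemble N M P Q" and N: "N \<ge> 1"
    and int0: "\<And>k m. k < N \<Longrightarrow> m < N \<Longrightarrow> integrable M (\<lambda>x. P k x * Q m x)"
    and int1: "\<And>k m. k < N \<Longrightarrow> m < N \<Longrightarrow> integrable M (\<lambda>x. P k x * Q m x * x)"
    and A: "\<And>k m. k < N \<Longrightarrow> m < N \<Longrightarrow> (LINT x|M. P k x * Q m x * x) = A k m"
begin

text \<open>Andreief's identity for \<open>f x = z - x\<close> evaluates the average characteristic polynomial at \<open>z\<close> as the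
determinant of \<open>z - A\<close>, since the functions are biorthogonal.\<close>

lemma avg_char_poly_eq_char_poly:
  "avg_char_poly N M P Q = char_poly (map_mat complex_of_real (Matrix.mat N N (\<lambda>(k, m). A k m)))"
    (is "_ = char_poly ?A")
proof -
  have ev: "avg_char_fun N M P Q z = poly (char_poly ?A) z" for z
  proof -
    have split: "(P k x * Q m x) *\<^sub>R (z - complex_of_real x) =
        z * complex_of_real (P k x * Q m x) - complex_of_real (P k x * Q m x * x)" for k m x
      by (simp add: scaleR_conv_of_real algebra_simps)
    have i: "integrable M (\<lambda>x. (P k x * Q m x) *\<^sub>R (z - complex_of_real x))" if "k < N" "m < N" for k m
      unfolding split using int0[OF that] int1[OF that]
      by (intro Bochner_Integration.integrable_diff integrable_mult_right integrable_of_real) auto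
    have e: "(\<integral>x. (P k x * Q m x) *\<^sub>R (z - complex_of_real x) \<partial>M) =
        (if k = m then z else 0) - complex_of_real (A k m)" if "k < N" "m < N" for k m
    proof -
      have "(\<integral>x. (P k x * Q m x) *\<^sub>R (z - complex_of_real x) \<partial>M) =
          z * complex_of_real (LINT x|M. P k x * Q m x) - complex_of_real (LINT x|M. P k x * Q m x * x)"
        unfolding split using int0[OF that] int1[OF that]
        by (subst Bochner_Integration.integral_diff) (auto intro!: integrable_mult_right integrable_of_real simp del: of_real_mult)
      moreover have "(LINT x|M. P k x * Q m x) = (if k = m then 1 else 0)"
        using be that by (simp add: biorthogonal_ensemble_def L2_inner_def)
      ultimately show ?thesis using A[OF that] by simp
    qed
    have "avg_char_fun N M P Q z =
        Determinant.det (Matrix.mat N N (\<lambda>(k, m). \<integral>x. (P k x * Q m x) *\<^sub>R (z - complex_of_real x) \<partial>M))"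
      unfolding avg_char_fun_def by (rule andreief_identity[OF be N _ i]) auto
    also have "\<dots> = poly (Determinant.det (char_poly_matrix ?A)) z"
      by (rule poly_det_cong[symmetric, of _ N]) (auto simp: char_poly_matrix_def e)
    finally show ?thesis by (simp add: char_poly_def)
  qed
  show ?thesis unfolding avg_char_poly_def
  proof (rule the_equality)
    show "\<forall>z. poly (char_poly ?A) z = avg_char_fun N M P Q z" by (simp add: ev)
    fix p assume "\<forall>z. poly p z = avg_char_fun N M P Q z"
    then have "poly p = poly (char_poly ?A)" by (auto simp: ev)
    then show "p = char_poly ?A" by (simp add: poly_eq_poly_eq_iff)
  qed
qed

lemma zero_distribution_moment:
  "measure_pmf.expectation (zero_distribution N M P Q) (\<lambda>z. z ^ l) =
     complex_of_real ((\<Sum>k<N. truncated_power A N l k k) / real N)"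
proof -
  let ?R = "Matrix.mat N N (\<lambda>(k, m). A k m)"
  let ?A = "map_mat complex_of_real ?R"
  have cR: "?R \<in> carrier_mat N N" by simp
  then have cA: "?A \<in> carrier_mat N N" by simp
  have size: "size (proots (char_poly ?A)) = N" by (rule power_sum_roots_char_poly(2)[OF cA])
  then have "proots (char_poly ?A) \<noteq> {#}" using N by auto
  then have "measure_pmf.expectation (zero_distribution N M P Q) (\<lambda>z. z ^ l) =
      (\<Sum>z\<in>#proots (char_poly ?A). z ^ l) / of_nat N"
    unfolding zero_distribution_def avg_char_poly_eq_char_poly
    by (simp add: expectation_pmf_of_multiset size)
  also have "(\<Sum>z\<in>#proots (char_poly ?A). z ^ l) = (\<Sum>k<N. (?A ^\<^sub>m l) $$ (k, k))"
    by (rule power_sum_roots_char_poly(1)[OF cA])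
  also have "?A ^\<^sub>m l = map_mat complex_of_real (?R ^\<^sub>m l)"
    by (rule of_real_hom.mat_hom_pow[OF cR, symmetric])
  also have "(\<Sum>k<N. map_mat complex_of_real (?R ^\<^sub>m l) $$ (k, k)) = (\<Sum>k<N. complex_of_real (truncated_power A N l k k))"
    using pow_carrier_mat[OF cR, of l] by (intro sum.cong refl) (simp add: truncated_power_eq_mat_power)
  finally show ?thesis by simp
qed

end

section \<open>Multiplication by powers of the variable\<close>

lemma square_integrable_mult_integrable:
  assumes "square_integrable M f" "square_integrable M g"
  shows "integrable M (\<lambda>x. f x * g x)"
proof (rule Bochner_Integration.integrable_bound)
  show "integrable M (\<lambda>x. (f x)\<^sup>2 + (g x)\<^sup>2)" "(\<lambda>x. f x * g x) \<in> borel_measurable M"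
    using assms by (auto simp: square_integrable_def)
  have "\<bar>a * b\<bar> \<le> a\<^sup>2 + b\<^sup>2" for a b :: real
  proof -
    have "2 * (\<bar>a\<bar> * \<bar>b\<bar>) \<le> a\<^sup>2 + b\<^sup>2" using sum_squares_bound[of "\<bar>a\<bar>" "\<bar>b\<bar>"] by simp
    moreover have "0 \<le> \<bar>a\<bar> * \<bar>b\<bar>" by simp
    ultimately show ?thesis unfolding abs_mult by linarith
  qed
  then show "AE x in M. norm (f x * g x) \<le> norm ((f x)\<^sup>2 + (g x)\<^sup>2)" by simp
qed

lemma square_integrable_scale:
  "square_integrable M f \<Longrightarrow> square_integrable M (\<lambda>x. c * f x)"
  by (auto simp: square_integrable_def power_mult_distrib)

lemma square_integrable_add:
  assumes "square_integrable M f" "square_integrable M g"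
  shows "square_integrable M (\<lambda>x. f x + g x)"
proof -
  have "integrable M (\<lambda>x. (f x)\<^sup>2 + (g x)\<^sup>2 + 2 * (f x * g x))"
    using assms square_integrable_mult_integrable[OF assms]
    by (auto simp: square_integrable_def)
  then show ?thesis using assms by (auto simp: square_integrable_def power2_sum mult.assoc)
qed

lemma square_integrable_sum:
  assumes "\<And>i. i \<in> I \<Longrightarrow> square_integrable M (f i)"
  shows "square_integrable M (\<lambda>x. \<Sum>i\<in>I. f i x)"
  using assms
proof (induction I rule: infinite_finite_induct)
  case (insert i I)
  then show ?case by (simp add: square_integrable_add)
qed (simp_all add: square_integrable_def)

lemma square_integrable_cong_AE:
  assumes "square_integrable M f" "g \<in> borel_measurable M" "AE x in M. g x = f x"
  shows "square_integrable M g"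
proof -
  have "integrable M (\<lambda>x. (f x)\<^sup>2) \<longleftrightarrow> integrable M (\<lambda>x. (g x)\<^sup>2)"
    by (rule integrable_cong_AE) (use assms in \<open>auto simp: square_integrable_def\<close>)
  then show ?thesis using assms by (auto simp: square_integrable_def)
qed

text \<open>The hypotheses on the infinite families for a single value of \<open>N\<close>.\<close>

locale biorthogonal_recurrence =
  fixes M :: "real measure" and P Q :: "nat \<Rightarrow> real \<Rightarrow> real" and q :: nat
  assumes sets_M: "sets M = sets borel"
    and sq_P: "\<And>k. square_integrable M (P k)"
    and sq_Q: "\<And>k. square_integrable M (Q k)"
    and biorth: "\<And>k m. L2_inner M (P k) (Q m) = (if k = m then 1 else 0)"
    and recurrence: "\<And>k. \<exists>c. AE x in M. x * P k x = (\<Sum>m\<le>k + q. c m * P m x)"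
begin

text \<open>Entries of the \<open>l\<close>-th power of the matrix of multiplication by \<open>x\<close> in the family \<open>P\<close>; see the
\<open>sublocale\<close> statement below.\<close>

definition power_coeff :: "nat \<Rightarrow> nat \<Rightarrow> nat \<Rightarrow> real" where
  "power_coeff l k m = L2_inner M (\<lambda>x. x ^ l * P k x) (Q m)"

lemma power_recurrence: "\<exists>c. AE x in M. x ^ l * P k x = (\<Sum>m\<le>k + l * q. c m * P m x)"
proof (induction l)
  case 0
  have "(\<Sum>m\<le>k. (if m = k then 1 else 0) * P m x) = P k x" for x
    by (simp add: if_distrib[of "\<lambda>u. u * _"] cong: if_cong)
  then show ?case by (intro exI[of _ "\<lambda>m. if m = k then 1 else 0"]) simp
next
  case (Suc l)
  then obtain c where c: "AE x in M. x ^ l * P k x = (\<Sum>m\<le>k + l * q. c m * P m x)" by blast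
  obtain d where d: "\<And>j. AE x in M. x * P j x = (\<Sum>m\<le>j + q. d j m * P m x)"
    using recurrence by metis
  then have d': "AE x in M. \<forall>j. x * P j x = (\<Sum>m\<le>j + q. d j m * P m x)"
    by (simp add: AE_all_countable)
  define c' where "c' i = (\<Sum>j\<le>k + l * q. c j * (if i \<le> j + q then d j i else 0))" for i
  have "AE x in M. x ^ Suc l * P k x = (\<Sum>i\<le>k + Suc l * q. c' i * P i x)"
    using c d'
  proof eventually_elim
    case (elim x)
    have "x ^ Suc l * P k x = (\<Sum>j\<le>k + l * q. c j * (x * P j x))"
      using elim(1) by (simp add: mult.assoc sum_distrib_left mult.left_commute)
    also have "\<dots> = (\<Sum>j\<le>k + l * q. c j * (\<Sum>i\<le>k + Suc l * q. (if i \<le> j + q then d j i else 0) * P i x))"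
    proof (intro sum.cong refl)
      fix j assume "j \<in> {..k + l * q}"
      then have "x * P j x = (\<Sum>i\<le>k + Suc l * q. (if i \<le> j + q then d j i else 0) * P i x)"
        unfolding spec[OF elim(2), of j] by (intro sum.mono_neutral_cong_left) auto
      then show "c j * (x * P j x) = c j * (\<Sum>i\<le>k + Suc l * q. (if i \<le> j + q then d j i else 0) * P i x)"
        by simp
    qed
    also have "\<dots> = (\<Sum>i\<le>k + Suc l * q. c' i * P i x)"
      unfolding c'_def sum_distrib_left sum_distrib_right by (subst sum.swap) (simp only: mult.assoc)
    finally show ?case .
  qed
  then show ?case by blast
qed

lemma P_measurable: "P k \<in> borel_measurable M"
  using sq_P by (simp add: square_integrable_def)

lemma power_P_measurable: "(\<lambda>x. x ^ l * P k x) \<in> borel_measurable M"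
proof -
  have "(\<lambda>x::real. x ^ l) \<in> borel_measurable M"
    by (simp add: measurable_cong_sets[OF sets_M refl])
  then show ?thesis using P_measurable by measurable
qed

text \<open>In this generality the measure need not have moments. Square integrability of \<open>x\<^sup>l P k\<close> comes from the
recurrence, which puts it in the span of the \<open>P m\<close>.\<close>

lemma sq_power_P: "square_integrable M (\<lambda>x. x ^ l * P k x)"
proof -
  obtain c where c: "AE x in M. x ^ l * P k x = (\<Sum>m\<le>k + l * q. c m * P m x)"
    using power_recurrence by blast
  show ?thesis
    by (rule square_integrable_cong_AE[OF _ power_P_measurable c])
       (intro square_integrable_sum square_integrable_scale sq_P)
qed

lemma integrable_power: "integrable M (\<lambda>x. x ^ l * P k x * Q m x)"
  using square_integrable_mult_integrable[OF sq_power_P sq_Q] .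

lemma integrable_PQ_power: "integrable M (\<lambda>x. P k x * Q m x * x ^ l)"
  using integrable_power[of l k m] by (simp add: ac_simps)

lemma integral_PQ_power: "(LINT x|M. P k x * Q m x * x ^ l) = power_coeff l k m"
  by (simp add: power_coeff_def L2_inner_def ac_simps)

text \<open>Pairing any expansion of \<open>x\<^sup>l P k\<close> with \<open>Q m\<close> identifies its coefficients, by biorthogonality.\<close>

lemma power_coeff_expansion:
  shows "AE x in M. x ^ l * P k x = (\<Sum>m\<le>k + l * q. power_coeff l k m * P m x)"
    and "k + l * q < m \<Longrightarrow> power_coeff l k m = 0"
proof -
  obtain c where c: "AE x in M. x ^ l * P k x = (\<Sum>m\<le>k + l * q. c m * P m x)"
    using power_recurrence by blast
  have eq: "power_coeff l k m = (if m \<le> k + l * q then c m else 0)" for m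
  proof -
    have i: "integrable M (\<lambda>x. c j * (P j x * Q m x))" for j
      using square_integrable_mult_integrable[OF sq_P sq_Q] by (rule integrable_mult_right)
    have Qm: "Q m \<in> borel_measurable M" using sq_Q by (simp add: square_integrable_def)
    have "power_coeff l k m = (LINT x|M. (\<Sum>j\<le>k + l * q. c j * (P j x * Q m x)))"
      unfolding power_coeff_def L2_inner_def
    proof (rule integral_cong_AE)
      show "AE x in M. x ^ l * P k x * Q m x = (\<Sum>j\<le>k + l * q. c j * (P j x * Q m x))"
        using c by eventually_elim (simp add: sum_distrib_right mult.assoc)
      show "(\<lambda>x. x ^ l * P k x * Q m x) \<in> borel_measurable M"
        using power_P_measurable Qm by (rule borel_measurable_times)
      show "(\<lambda>x. \<Sum>j\<le>k + l * q. c j * (P j x * Q m x)) \<in> borel_measurable M"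
        by (intro borel_measurable_sum borel_measurable_integrable i)
    qed
    also have "\<dots> = (\<Sum>j\<le>k + l * q. c j * L2_inner M (P j) (Q m))"
      unfolding L2_inner_def by (subst Bochner_Integration.integral_sum[OF i]) simp
    also have "\<dots> = (if m \<le> k + l * q then c m else 0)"
      by (simp add: biorth if_distrib cong: if_cong)
    finally show ?thesis .
  qed
  show "AE x in M. x ^ l * P k x = (\<Sum>m\<le>k + l * q. power_coeff l k m * P m x)"
    using c by eventually_elim (simp add: eq)
  show "power_coeff l k m = 0" if "k + l * q < m" using that by (simp add: eq)
qed

text \<open>The semigroup law is \<open>x\<^sup>a\<^sup>+\<^sup>b = x\<^sup>b x\<^sup>a\<close>: expand \<open>x\<^sup>a P k\<close> first, then multiply by \<open>x\<^sup>b\<close> and pair with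
\<open>Q m\<close>.\<close>

sublocale banded_semigroup power_coeff q
proof
  show "power_coeff 0 k m = (if k = m then 1 else 0)" for k m
    using biorth by (simp add: power_coeff_def)
  show "power_coeff l k m = 0" if "k + l * q < m" for k l m using power_coeff_expansion(2)[OF that] .
  fix a b k m
  have i: "integrable M (\<lambda>x. power_coeff a k j * (x ^ b * P j x * Q m x))" for j
    using integrable_power by (rule integrable_mult_right)
  have Qm: "Q m \<in> borel_measurable M" using sq_Q by (simp add: square_integrable_def)
  have "power_coeff (a + b) k m = (LINT x|M. (\<Sum>j\<le>k + a * q. power_coeff a k j * (x ^ b * P j x * Q m x)))"
    unfolding power_coeff_def[of "a + b"] L2_inner_def
  proof (rule integral_cong_AE)
    show "AE x in M. x ^ (a + b) * P k x * Q m x = (\<Sum>j\<le>k + a * q. power_coeff a k j * (x ^ b * P j x * Q m x))"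
      using power_coeff_expansion(1)[of a k]
    proof eventually_elim
      case (elim x)
      have "x ^ (a + b) * P k x * Q m x = x ^ b * Q m x * (x ^ a * P k x)"
        by (simp add: power_add ac_simps)
      also have "\<dots> = (\<Sum>j\<le>k + a * q. power_coeff a k j * (x ^ b * P j x * Q m x))"
        unfolding elim by (simp add: sum_distrib_left ac_simps)
      finally show ?case .
    qed
    show "(\<lambda>x. x ^ (a + b) * P k x * Q m x) \<in> borel_measurable M"
      using power_P_measurable Qm by (rule borel_measurable_times)
    show "(\<lambda>x. \<Sum>j\<le>k + a * q. power_coeff a k j * (x ^ b * P j x * Q m x)) \<in> borel_measurable M"
      by (intro borel_measurable_sum borel_measurable_integrable i)
  qed
  also have "\<dots> = (\<Sum>j\<le>k + a * q. power_coeff a k j * power_coeff b j m)"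
    unfolding power_coeff_def[of b] L2_inner_def by (subst Bochner_Integration.integral_sum[OF i]) simp
  finally show "power_coeff (a + b) k m = (\<Sum>j\<le>k + a * q. power_coeff a k j * power_coeff b j m)" .
qed

end

text \<open>\<^const>\<open>Max\<close> bounds its elements only on a finite set; the indices allowed here are at most \<open>(1 + \<epsilon>) N\<close>.\<close>

lemma Max_near_diagonal_ge:
  assumes "N \<ge> 1" "\<epsilon> > 0"
    and "\<bar>real k / real N - 1\<bar> \<le> \<epsilon>" "\<bar>real m / real N - 1\<bar> \<le> \<epsilon>"
  shows "\<bar>L2_inner M (\<lambda>x. x * P k x) (Q m)\<bar> \<le> max_coeff_near_diagonal \<epsilon> N M P Q"
  unfolding max_coeff_near_diagonal_def
proof (rule Max_ge)
  let ?B = "{..nat \<lceil>(1 + \<epsilon>) * real N\<rceil>}"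
  have "k \<in> ?B" if "\<bar>real k / real N - 1\<bar> \<le> \<epsilon>" for k
  proof -
    have "real k \<le> (1 + \<epsilon>) * real N" using that assms(1) by (simp add: abs_le_iff field_simps)
    then show ?thesis by (simp add: le_nat_iff le_ceiling_iff)
  qed
  then have "{\<bar>L2_inner M (\<lambda>x. x * P k x) (Q m)\<bar> | k m.
      \<bar>real k / real N - 1\<bar> \<le> \<epsilon> \<and> \<bar>real m / real N - 1\<bar> \<le> \<epsilon>}
    \<subseteq> (\<lambda>(k, m). \<bar>L2_inner M (\<lambda>x. x * P k x) (Q m)\<bar>) ` (?B \<times> ?B)" by force
  then show "finite {\<bar>L2_inner M (\<lambda>x. x * P k x) (Q m)\<bar> | k m.
      \<bar>real k / real N - 1\<bar> \<le> \<epsilon> \<and> \<bar>real m / real N - 1\<bar> \<le> \<epsilon>}"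
    by (rule finite_subset) simp
qed (use assms in blast)

section \<open>Almost sure convergence and asymptotics\<close>

text \<open>The expected value of a tail of \<open>\<Sum>N. (Y N)\<^sup>2\<close> is finite, so this series converges almost surely and its terms tend
to 0.\<close>

lemma AE_tendsto_zero_of_summable_second_moments:
  fixes E :: "nat \<Rightarrow> 'a measure" and Y :: "nat \<Rightarrow> 'a \<Rightarrow> real"
  assumes prob: "\<And>N. N \<ge> 1 \<Longrightarrow> prob_space (E N)"
    and Y: "\<And>N. N \<ge> 1 \<Longrightarrow> Y N \<in> borel_measurable (E N)"
    and Y2: "\<And>N. N \<ge> 1 \<Longrightarrow> integrable (E N) (\<lambda>x. (Y N x)\<^sup>2)"
    and bound: "eventually (\<lambda>N. (LINT x|E N. (Y N x)\<^sup>2) \<le> b N) sequentially"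
    and b: "summable b"
  shows "AE \<omega> in PiM {1..} E. (\<lambda>N. Y N (\<omega> N)) \<longlonglongrightarrow> 0"
proof -
  obtain N0 where N0: "\<And>N. N \<ge> N0 \<Longrightarrow> (LINT x|E N. (Y N x)\<^sup>2) \<le> b N"
    using bound by (auto simp: eventually_sequentially)
  \<comment> \<open>Discarding finitely many terms makes the bound hold everywhere and stays inside the index set.\<close>
  define K where "K = max N0 1"
  have K: "n + K \<ge> 1" "n + K \<ge> N0" for n by (auto simp: K_def)
  define Z where "Z n \<omega> = (Y (n + K) (\<omega> (n + K)))\<^sup>2" for n and \<omega> :: "nat \<Rightarrow> 'a"
  have comp: "(\<lambda>\<omega>. \<omega> N) \<in> measurable (PiM {1..} E) (E N)" if "N \<ge> 1" for N
    using that by (intro measurable_component_singleton) simp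
  have Zm[measurable]: "Z n \<in> borel_measurable (PiM {1..} E)" for n
    unfolding Z_def[abs_def]
    by (intro borel_measurable_power measurable_compose[OF comp[OF K(1)] Y[OF K(1)]])
  have expZ: "(\<integral>\<^sup>+\<omega>. ennreal (Z n \<omega>) \<partial>PiM {1..} E) \<le> ennreal (b (n + K))" for n
  proof -
    have "(\<integral>\<^sup>+\<omega>. ennreal (Z n \<omega>) \<partial>PiM {1..} E) =
        (\<integral>\<^sup>+x. ennreal ((Y (n + K) x)\<^sup>2) \<partial>distr (PiM {1..} E) (E (n + K)) (\<lambda>\<omega>. \<omega> (n + K)))"
      unfolding Z_def using Y[OF K(1)] comp[OF K(1)] by (subst nn_integral_distr) auto
    also have "distr (PiM {1..} E) (E (n + K)) (\<lambda>\<omega>. \<omega> (n + K)) = E (n + K)"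
      using prob K(1) by (intro distr_PiM_component) auto
    also have "(\<integral>\<^sup>+x. ennreal ((Y (n + K) x)\<^sup>2) \<partial>E (n + K)) = ennreal (LINT x|E (n + K). (Y (n + K) x)\<^sup>2)"
      by (intro nn_integral_eq_integral Y2 K) auto
    also have "\<dots> \<le> ennreal (b (n + K))" by (intro ennreal_leI N0 K)
    finally show ?thesis .
  qed
  have b0: "0 \<le> b (n + K)" for n
    using order_trans[OF _ N0[OF K(2)]] by (simp add: integral_nonneg)
  have "(\<integral>\<^sup>+\<omega>. (\<Sum>n. ennreal (Z n \<omega>)) \<partial>PiM {1..} E) = (\<Sum>n. \<integral>\<^sup>+\<omega>. ennreal (Z n \<omega>) \<partial>PiM {1..} E)"
    by (intro nn_integral_suminf) measurable
  also have "\<dots> \<le> (\<Sum>n. ennreal (b (n + K)))"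
    by (intro suminf_le expZ) auto
  also have "\<dots> = ennreal (\<Sum>n. b (n + K))"
    using b b0 by (intro suminf_ennreal2) (auto simp: summable_iff_shift)
  finally have "(\<integral>\<^sup>+\<omega>. (\<Sum>n. ennreal (Z n \<omega>)) \<partial>PiM {1..} E) \<noteq> \<infinity>"
    by (auto simp: top_unique)
  then have "AE \<omega> in PiM {1..} E. (\<Sum>n. ennreal (Z n \<omega>)) \<noteq> \<infinity>"
    by (intro nn_integral_PInf_AE) measurable
  then show ?thesis
  proof eventually_elim
    case (elim \<omega>)
    have "summable (\<lambda>n. Z n \<omega>)"
      using elim by (intro summable_suminf_not_top) (auto simp: Z_def)
    then have "(\<lambda>n. sqrt (Z n \<omega>)) \<longlonglongrightarrow> sqrt 0"
      by (intro tendsto_real_sqrt summable_LIMSEQ_zero)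
    then have "(\<lambda>n. \<bar>Y (n + K) (\<omega> (n + K))\<bar>) \<longlonglongrightarrow> 0" by (simp add: Z_def)
    then have "(\<lambda>n. Y (n + K) (\<omega> (n + K))) \<longlonglongrightarrow> 0" by (simp add: tendsto_rabs_zero_iff)
    then show ?case by (rule LIMSEQ_offset)
  qed
qed

lemma empirical_measure_real_distribution: "real_distribution (empirical_measure N x)"
  unfolding empirical_measure_def
  by (intro prob_space.real_distribution_distr measure_pmf.prob_space_axioms) simp

lemma empirical_measure_moment:
  assumes "N \<ge> 1"
  shows "integrable (empirical_measure N x) (\<lambda>t. t ^ l)"
    and "(LINT t|empirical_measure N x. t ^ l) = (\<Sum>i<N. x i ^ l) / real N"
proof -
  have ne: "{..<N} \<noteq> {}" using assms by (auto simp: lessThan_empty_iff)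
  have "integrable (measure_pmf (pmf_of_set {..<N})) (\<lambda>i. x i ^ l)"
    by (rule integrable_measure_pmf_finite) (simp add: ne)
  then show "integrable (empirical_measure N x) (\<lambda>t. t ^ l)"
    unfolding empirical_measure_def by (subst integrable_distr_eq) auto
  have "(LINT t|empirical_measure N x. t ^ l) = (LINT i|measure_pmf (pmf_of_set {..<N}). x i ^ l)"
    unfolding empirical_measure_def by (subst integral_distr) auto
  also have "\<dots> = (\<Sum>i<N. x i ^ l) / real N"
    using ne by (subst integral_pmf_of_set) auto
  finally show "(LINT t|empirical_measure N x. t ^ l) = (\<Sum>i<N. x i ^ l) / real N" .
qed

text \<open>Both expressions are polynomials in \<open>q N\<close> and \<open>\<bar>C N\<bar>\<close> of degree at most \<open>4 l + 2\<close>. Using the hypotheses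
with exponent \<open>1 / (2 (4 l + 2))\<close> bounds them by a multiple of \<open>N powr (1/2)\<close>. Any exponent below 1 would
do for the later use.\<close>

lemma subpolynomial_product_bounds:
  fixes q :: "nat \<Rightarrow> nat" and C :: "nat \<Rightarrow> real" and l :: nat
  assumes q: "\<And>n::nat. n \<ge> 1 \<Longrightarrow> (\<lambda>N. real (q N)) \<in> o(\<lambda>N. real N powr (1 / real n))"
    and C: "\<And>n::nat. n \<ge> 1 \<Longrightarrow> C \<in> o(\<lambda>N. real N powr (1 / real n))"
  obtains K where
    "eventually (\<lambda>N. 2 * (real l * real (q N)) * ((4 * real l * real (q N) + 1) * \<bar>C N\<bar>) ^ l \<le> K * real N powr (1/2)) sequentially"
    "eventually (\<lambda>N. (real l * real (q N))\<^sup>2 * (((4 * real l * real (q N) + 1) * \<bar>C N\<bar>) ^ l)\<^sup>2 \<le> K * real N powr (1/2)) sequentially"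
proof -
  define n where "n = 2 * (4 * l + 2)"
  define s where "s N = real N powr (1 / real n)" for N :: nat
  define a where "a = 4 * real l + 1"
  define K where "K = 2 * real l * a ^ l + (real l)\<^sup>2 * (a ^ l)\<^sup>2"
  have n: "n \<ge> 1" by (simp add: n_def)
  have a: "a \<ge> 1" by (simp add: a_def)
  have K0: "K \<ge> 0" using a by (simp add: K_def)
  have Kn: "2 * real l * a ^ l \<le> K" "(real l)\<^sup>2 * (a ^ l)\<^sup>2 \<le> K" using a by (auto simp: K_def)
  have ev_q: "eventually (\<lambda>N. real (q N) \<le> s N) sequentially"
    using landau_o.smallD[OF q[OF n], of 1, simplified] by eventually_elim (simp add: s_def)
  have ev_C: "eventually (\<lambda>N. \<bar>C N\<bar> \<le> s N) sequentially"
    using landau_o.smallD[OF C[OF n], of 1, simplified] by eventually_elim (simp add: s_def)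
  have both: "2 * (real l * real (q N)) * ((4 * real l * real (q N) + 1) * \<bar>C N\<bar>) ^ l \<le> K * real N powr (1/2)"
    "(real l * real (q N))\<^sup>2 * (((4 * real l * real (q N) + 1) * \<bar>C N\<bar>) ^ l)\<^sup>2 \<le> K * real N powr (1/2)"
    if qs: "real (q N) \<le> s N" and Cs: "\<bar>C N\<bar> \<le> s N" and N: "N \<ge> 1" for N
  proof -
    have s1: "s N \<ge> 1" using N by (simp add: s_def ge_one_powr_ge_zero)
    have spow: "s N ^ (4 * l + 2) = real N powr (1/2)"
    proof -
      have "s N ^ (4 * l + 2) = s N powr real (4 * l + 2)"
        using s1 by (intro powr_realpow[symmetric]) auto
      also have "\<dots> = real N powr (1 / real n * real (4 * l + 2))"
        unfolding s_def by (rule powr_powr)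
      also have "1 / real n * real (4 * l + 2) = 1 / 2" by (simp add: n_def field_simps)
      finally show ?thesis .
    qed
    have base: "(4 * real l * real (q N) + 1) * \<bar>C N\<bar> \<le> a * (s N)\<^sup>2"
    proof -
      have "4 * real l * real (q N) + 1 \<le> a * s N"
        using mult_left_mono[OF qs, of "4 * real l"] s1 by (simp add: a_def algebra_simps)
      then have "(4 * real l * real (q N) + 1) * \<bar>C N\<bar> \<le> (a * s N) * s N"
        using Cs a s1 by (intro mult_mono) auto
      then show ?thesis by (simp add: power2_eq_square mult.assoc)
    qed
    have pw: "((4 * real l * real (q N) + 1) * \<bar>C N\<bar>) ^ l \<le> a ^ l * s N ^ (2 * l)"
      using power_mono[OF base, of l] by (simp add: power_mult_distrib power_mult)
    have pw0: "0 \<le> ((4 * real l * real (q N) + 1) * \<bar>C N\<bar>) ^ l" by simp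
    have "2 * (real l * real (q N)) * ((4 * real l * real (q N) + 1) * \<bar>C N\<bar>) ^ l
        \<le> 2 * (real l * s N) * (a ^ l * s N ^ (2 * l))"
      using qs s1 pw0 by (intro mult_mono pw) (auto intro!: mult_left_mono)
    also have "\<dots> = 2 * real l * a ^ l * s N ^ (2 * l + 1)" by simp
    also have "\<dots> \<le> K * s N ^ (4 * l + 2)"
      using s1 a K0 by (intro mult_mono Kn power_increasing) auto
    finally show "2 * (real l * real (q N)) * ((4 * real l * real (q N) + 1) * \<bar>C N\<bar>) ^ l \<le> K * real N powr (1/2)"
      by (simp only: spow)
    have "(real l * real (q N))\<^sup>2 * (((4 * real l * real (q N) + 1) * \<bar>C N\<bar>) ^ l)\<^sup>2
        \<le> (real l * s N)\<^sup>2 * (a ^ l * s N ^ (2 * l))\<^sup>2"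
      using qs s1 pw0 by (intro mult_mono power_mono pw) (auto intro!: mult_left_mono)
    also have "\<dots> = (real l)\<^sup>2 * (a ^ l)\<^sup>2 * s N ^ (4 * l + 2)"
    proof -
      have "(s N)\<^sup>2 * (s N ^ (2 * l))\<^sup>2 = s N ^ (4 * l + 2)"
        by (simp add: mult.commute flip: power_mult power_add)
      then show ?thesis by (simp only: power_mult_distrib) (simp only: ac_simps)
    qed
    also have "\<dots> \<le> K * s N ^ (4 * l + 2)"
      using s1 a by (intro mult_right_mono Kn) auto
    finally show "(real l * real (q N))\<^sup>2 * (((4 * real l * real (q N) + 1) * \<bar>C N\<bar>) ^ l)\<^sup>2 \<le> K * real N powr (1/2)"
      by (simp only: spow)
  qed
  show ?thesis
  proof (rule that[of K])
    show "eventually (\<lambda>N. 2 * (real l * real (q N)) * ((4 * real l * real (q N) + 1) * \<bar>C N\<bar>) ^ l \<le> K * real N powr (1/2)) sequentially"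
      using ev_q ev_C eventually_ge_at_top[of 1] by eventually_elim (rule both(1))
    show "eventually (\<lambda>N. (real l * real (q N))\<^sup>2 * (((4 * real l * real (q N) + 1) * \<bar>C N\<bar>) ^ l)\<^sup>2 \<le> K * real N powr (1/2)) sequentially"
      using ev_q ev_C eventually_ge_at_top[of 1] by eventually_elim (rule both(2))
  qed
qed

section \<open>Moments of the empirical measure and of the zeros\<close>

context biorthogonal_recurrence
begin

lemma integrable_PQ: "integrable M (\<lambda>x. P k x * Q m x)"
  using integrable_PQ_power[of k m 0] by simp

lemma power_measurable: "(\<lambda>x :: real. x ^ l) \<in> borel_measurable borel"
  by measurable

lemma integrable_PQ_power_square: "integrable M (\<lambda>x. P k x * Q m x * (x ^ l)\<^sup>2)"
  using integrable_PQ_power[of k m "l + l"] by (simp add: power_add power2_eq_square)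

lemma integral_PQ_power_square: "(LINT x|M. P k x * Q m x * (x ^ l)\<^sup>2) = power_coeff (l + l) k m"
  using integral_PQ_power[of k m "l + l"] by (simp add: power_add power2_eq_square)

context
  fixes N :: nat
  assumes be: "biorthogonal_ensemble N M P Q" and N: "N \<ge> 1"
begin

lemmas mean_power = linear_statistic_mean[OF be N power_measurable integrable_PQ
    integrable_PQ_power integrable_PQ_power_square integral_PQ_power integral_PQ_power_square]

lemmas second_moment_power = linear_statistic_second_moment[OF be N power_measurable integrable_PQ
    integrable_PQ_power integrable_PQ_power_square integral_PQ_power integral_PQ_power_square]

lemma power_sum_variance:
  defines "m \<equiv> \<lambda>l. \<Sum>k<N. power_coeff l k k"
  shows "integrable (ensemble_measure N M P Q) (\<lambda>x. ((\<Sum>i<N. x i ^ l) - m l)\<^sup>2)"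
    and "(\<integral>x. ((\<Sum>i<N. x i ^ l) - m l)\<^sup>2 \<partial>ensemble_measure N M P Q) =
      (\<Sum>k<N. power_coeff (l + l) k k - (\<Sum>m<N. power_coeff l k m * power_coeff l m k))"
proof -
  interpret E: prob_space "ensemble_measure N M P Q"
    using be by (simp add: biorthogonal_ensemble_def)
  have sq: "((\<Sum>i<N. x i ^ l) - m l)\<^sup>2 = (\<Sum>i<N. x i ^ l)\<^sup>2 - 2 * m l * (\<Sum>i<N. x i ^ l) + (m l)\<^sup>2"
    for x :: "nat \<Rightarrow> real"
    by (simp add: power2_diff)
  show "integrable (ensemble_measure N M P Q) (\<lambda>x. ((\<Sum>i<N. x i ^ l) - m l)\<^sup>2)"
    unfolding sq by (intro Bochner_Integration.integrable_add Bochner_Integration.integrable_diff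
        integrable_mult_right E.integrable_const mean_power second_moment_power)
  have "(\<integral>x. ((\<Sum>i<N. x i ^ l) - m l)\<^sup>2 \<partial>ensemble_measure N M P Q) =
      (\<integral>x. (\<Sum>i<N. x i ^ l)\<^sup>2 \<partial>ensemble_measure N M P Q)
      - 2 * m l * (\<integral>x. (\<Sum>i<N. x i ^ l) \<partial>ensemble_measure N M P Q) + (m l)\<^sup>2"
    unfolding sq using mean_power(1)[of l] second_moment_power(1)[of l]
    by (simp add: E.prob_space)
  then show "(\<integral>x. ((\<Sum>i<N. x i ^ l) - m l)\<^sup>2 \<partial>ensemble_measure N M P Q) =
      (\<Sum>k<N. power_coeff (l + l) k k - (\<Sum>m<N. power_coeff l k m * power_coeff l m k))"
    unfolding mean_power(2) second_moment_power(2) by (simp add: m_def power2_eq_square)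
qed

lemma zero_distribution_moment_power_coeff:
  "measure_pmf.expectation (zero_distribution N M P Q) (\<lambda>z. z ^ l) =
     complex_of_real ((\<Sum>k<N. truncated_power (power_coeff 1) N l k k) / real N)"
proof (rule zero_distribution_moment[OF be N integrable_PQ])
  show "integrable M (\<lambda>x. P k x * Q m x * x)" for k m using integrable_PQ_power[of k m 1] by simp
  show "(LINT x|M. P k x * Q m x * x) = power_coeff 1 k m" for k m using integral_PQ_power[of k m 1] by simp
qed

end

end

text \<open>Combines the estimates for each \<open>N\<close>: eventually the window of radius \<open>2 l q\<close> around \<open>N\<close> lies inside the region
\<open>\<bar>k / N - 1\<bar> \<le> \<epsilon>\<close> where the matrix entries are controlled.\<close>

theorem corollary1p4:
  fixes \<mu> :: "nat \<Rightarrow> real measure"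
    and P Q :: "nat \<Rightarrow> nat \<Rightarrow> real \<Rightarrow> real"
    and \<epsilon> :: real
    and \<mu>_star :: "real measure"
  assumes "\<And>N. N \<ge> 1 \<Longrightarrow> biorthogonal_ensemble N (\<mu> N) (P N) (Q N)"
    and "structural_assumption \<mu> P Q"
    and "\<epsilon> > 0"
    and "\<And>n::nat. n \<ge> 1 \<Longrightarrow>
           (\<lambda>N. max_coeff_near_diagonal \<epsilon> N (\<mu> N) (P N) (Q N)) \<in> o(\<lambda>N. real N powr (1 / real n))"
    and "real_distribution \<mu>_star"
    and "characterized_by_moments \<mu>_star"
    and "\<And>l::nat.
           (\<lambda>N. measure_pmf.expectation (zero_distribution N (\<mu> N) (P N) (Q N)) (\<lambda>z. z ^ l))
             \<longlonglongrightarrow> complex_of_real (LINT x|\<mu>_star. x ^ l)"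
  shows "AE \<omega> in Pi\<^sub>M {1..} (\<lambda>N. ensemble_measure N (\<mu> N) (P N) (Q N)).
           weak_conv_m (\<lambda>N. empirical_measure N (\<omega> N)) \<mu>_star"
proof -
  note be = assms(1)
  obtain q where q: "\<And>n::nat. n \<ge> 1 \<Longrightarrow> (\<lambda>N. real (q N)) \<in> o(\<lambda>N. real N powr (1 / real n))"
    and rec: "\<And>N k. N \<ge> 1 \<Longrightarrow> \<exists>c. AE x in \<mu> N. x * P N k x = (\<Sum>m\<le>k + q N. c m * P N m x)"
    using assms(2) unfolding structural_assumption_def by blast
  have br: "biorthogonal_recurrence (\<mu> N) (P N) (Q N) (q N)" if N: "N \<ge> 1" for N
  proof
    show "sets (\<mu> N) = sets borel" using be[OF N] by (simp add: biorthogonal_ensemble_def)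
    show "square_integrable (\<mu> N) (P N k)" "square_integrable (\<mu> N) (Q N k)"
      "L2_inner (\<mu> N) (P N k) (Q N m) = (if k = m then 1 else 0)" for k m
      using assms(2) N unfolding structural_assumption_def by blast+
  qed (rule rec[OF N])
  define C where "C N = max_coeff_near_diagonal \<epsilon> N (\<mu> N) (P N) (Q N)" for N
  define G where "G N = biorthogonal_recurrence.power_coeff (\<mu> N) (P N) (Q N)" for N
  define E where "E N = ensemble_measure N (\<mu> N) (P N) (Q N)" for N
  define mean where "mean l N = (\<Sum>k<N. G N l k k)" for l N
  define zsum where "zsum l N = (\<Sum>k<N. truncated_power (G N 1) N l k k)" for l N
  have prob: "prob_space (E N)" if "N \<ge> 1" for N
    using be[OF that] by (simp add: biorthogonal_ensemble_def E_def)
  have C': "C \<in> o(\<lambda>N. real N powr (1 / real n))" if "n \<ge> 1" for n :: nat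
    using assms(4)[OF that] by (simp add: C_def[abs_def])
  have estimates: "\<exists>K. eventually (\<lambda>N. \<bar>mean l N - zsum l N\<bar> \<le> K * real N powr (1/2) \<and>
      (LINT x|E N. ((\<Sum>i<N. x i ^ l) - mean l N)\<^sup>2) \<le> K * real N powr (1/2)) sequentially" for l
  proof -
    obtain K where K:
      "eventually (\<lambda>N. 2 * (real l * real (q N)) * ((4 * real l * real (q N) + 1) * \<bar>C N\<bar>) ^ l \<le> K * real N powr (1/2)) sequentially"
      "eventually (\<lambda>N. (real l * real (q N))\<^sup>2 * (((4 * real l * real (q N) + 1) * \<bar>C N\<bar>) ^ l)\<^sup>2 \<le> K * real N powr (1/2)) sequentially"
      by (rule subpolynomial_product_bounds[where q = q and C = C and l = l, OF q C'])
    \<comment> \<open>Small enough for \<open>2 l q\<close> to be at most both \<open>N\<close> and \<open>\<epsilon> N\<close>; the summand 1 keeps \<open>c\<close> defined for \<open>l = 0\<close>.\<close>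
    define c where "c = min 1 \<epsilon> / (2 * real l + 1)"
    have c: "c > 0" using assms(3) by (simp add: c_def)
    have "eventually (\<lambda>N. real (q N) \<le> c * real N) sequentially"
      using landau_o.smallD[OF q[of 1], of c] c by simp
    with K eventually_ge_at_top[of 1]
    have "eventually (\<lambda>N. \<bar>mean l N - zsum l N\<bar> \<le> K * real N powr (1/2) \<and>
      (LINT x|E N. ((\<Sum>i<N. x i ^ l) - mean l N)\<^sup>2) \<le> K * real N powr (1/2)) sequentially"
    proof eventually_elim
      case (elim N)
      then have N: "N \<ge> 1" by simp
      interpret biorthogonal_recurrence "\<mu> N" "P N" "Q N" "q N" by (rule br[OF N])
      have small: "2 * real l * real (q N) \<le> min 1 \<epsilon> * real N"
      proof -
        have "2 * real l * real (q N) \<le> (2 * real l + 1) * real (q N)" by (simp add: algebra_simps)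
        also have "\<dots> \<le> (2 * real l + 1) * (c * real N)" using elim by (intro mult_left_mono) auto
        also have "\<dots> = min 1 \<epsilon> * real N" by (simp add: c_def)
        finally show ?thesis .
      qed
      have "2 * real l * real (q N) \<le> 1 * real N"
        using small by (rule order_trans) (intro mult_right_mono, auto)
      then have "real (2 * l * q N) \<le> real N" by simp
      then have big: "2 * l * q N \<le> N" by (simp only: of_nat_le_iff)
      have eps: "2 * real l * real (q N) \<le> \<epsilon> * real N"
        using small by (rule order_trans) (intro mult_right_mono, auto)
      have near: "\<bar>real i / real N - 1\<bar> \<le> \<epsilon>" if "N - 2 * l * q N \<le> i" "i \<le> N + 2 * l * q N" for i
      proof -
        have "real i \<le> real (N + 2 * l * q N)" using that(2) by (simp only: of_nat_le_iff)
        moreover have "real N \<le> real (i + 2 * l * q N)" using that(1) by (simp only: of_nat_le_iff)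
        ultimately have "\<bar>real i - real N\<bar> \<le> \<epsilon> * real N" using eps by (simp add: abs_le_iff)
        moreover have "real i / real N - 1 = (real i - real N) / real N" using N by (simp add: field_simps)
        ultimately show ?thesis using N by (simp add: field_simps)
      qed
      have bound: "\<bar>power_coeff 1 i j\<bar> \<le> \<bar>C N\<bar>"
        if "N - 2 * l * q N \<le> i" "i \<le> N + 2 * l * q N" "N - 2 * l * q N \<le> j" "j \<le> N + 2 * l * q N" for i j
        using Max_near_diagonal_ge[OF N assms(3) near near, OF that, of "\<mu> N" "P N" "Q N"]
        unfolding power_coeff_def C_def by simp
      have "\<bar>mean l N - zsum l N\<bar> \<le> 2 * (real l * real (q N)) * ((4 * real l * real (q N) + 1) * \<bar>C N\<bar>) ^ l"
        unfolding mean_def zsum_def G_def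
        by (rule trace_power_difference[OF big _ bound]) auto
      moreover have "(LINT x|E N. ((\<Sum>i<N. x i ^ l) - mean l N)\<^sup>2) \<le>
          (real l * real (q N))\<^sup>2 * (((4 * real l * real (q N) + 1) * \<bar>C N\<bar>) ^ l)\<^sup>2"
        unfolding E_def mean_def G_def power_sum_variance(2)[OF be[OF N] N]
        by (rule order_trans[OF abs_ge_self variance_sum_bound[OF big _ bound]]) auto
      ultimately show ?case using elim by linarith
    qed
    then show ?thesis by blast
  qed
  have mean_lim: "(\<lambda>N. mean l N / real N) \<longlonglongrightarrow> (LINT x|\<mu>_star. x ^ l)" for l
  proof -
    obtain K where K: "eventually (\<lambda>N. \<bar>mean l N - zsum l N\<bar> \<le> K * real N powr (1/2)) sequentially"
      using estimates[of l] unfolding eventually_conj_iff by blast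
    have "eventually (\<lambda>N. measure_pmf.expectation (zero_distribution N (\<mu> N) (P N) (Q N)) (\<lambda>z. z ^ l)
        = complex_of_real (zsum l N / real N)) sequentially"
      using eventually_ge_at_top[of 1]
    proof eventually_elim
      case (elim N)
      then show ?case
        using biorthogonal_recurrence.zero_distribution_moment_power_coeff[OF br be, of N l]
        by (simp only: zsum_def G_def)
    qed
    then have "(\<lambda>N. complex_of_real (zsum l N / real N)) \<longlonglongrightarrow> complex_of_real (LINT x|\<mu>_star. x ^ l)"
      using assms(7)[of l] by (rule Lim_transform_eventually[rotated])
    then have z: "(\<lambda>N. zsum l N / real N) \<longlonglongrightarrow> (LINT x|\<mu>_star. x ^ l)"
      by (simp only: tendsto_of_real_iff)
    have "(\<lambda>N. mean l N / real N - zsum l N / real N) \<longlonglongrightarrow> 0"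
    proof (rule Lim_null_comparison)
      show "(\<lambda>N. K * real N powr (-1/2)) \<longlonglongrightarrow> 0" by real_asymp
      show "eventually (\<lambda>N. norm (mean l N / real N - zsum l N / real N) \<le> K * real N powr (-1/2)) sequentially"
        using K eventually_ge_at_top[of 1]
      proof eventually_elim
        case (elim N)
        have "norm (mean l N / real N - zsum l N / real N) = \<bar>mean l N - zsum l N\<bar> / real N"
          by (simp flip: diff_divide_distrib)
        also have "\<dots> \<le> K * real N powr (1/2) / real N" using elim by (intro divide_right_mono) auto
        also have "\<dots> = K * (real N powr (1/2) / real N powr 1)" by simp
        also have "\<dots> = K * real N powr (1/2 - 1)" by (simp only: powr_diff)
        finally show ?case by simp
      qed
    qed
    from tendsto_add[OF this z] show ?thesis by simp
  qed
  have centred: "AE \<omega> in PiM {1..} E. (\<lambda>N. ((\<Sum>i<N. \<omega> N i ^ l) - mean l N) / real N) \<longlonglongrightarrow> 0" for l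
  proof -
    obtain K where K: "eventually (\<lambda>N. (LINT x|E N. ((\<Sum>i<N. x i ^ l) - mean l N)\<^sup>2) \<le> K * real N powr (1/2)) sequentially"
      using estimates[of l] unfolding eventually_conj_iff by blast
    have stat: "integrable (E N) (\<lambda>x. \<Sum>i<N. x i ^ l)"
      "integrable (E N) (\<lambda>x. ((\<Sum>i<N. x i ^ l) - mean l N)\<^sup>2)" if "N \<ge> 1" for N
      unfolding E_def mean_def G_def
      using biorthogonal_recurrence.mean_power(1)[OF br be, of N l]
        biorthogonal_recurrence.power_sum_variance(1)[OF br be, of N l] that by auto
    show ?thesis
    proof (rule AE_tendsto_zero_of_summable_second_moments[where Y = "\<lambda>N x. ((\<Sum>i<N. x i ^ l) - mean l N) / real N"])
      show "summable (\<lambda>N. K * real N powr (-3/2))"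
        by (intro summable_mult) (simp add: summable_real_powr_iff)
      show "(\<lambda>x. ((\<Sum>i<N. x i ^ l) - mean l N) / real N) \<in> borel_measurable (E N)" if "N \<ge> 1" for N
        using borel_measurable_integrable[OF stat(1)[OF that]] by simp
      show "integrable (E N) (\<lambda>x. (((\<Sum>i<N. x i ^ l) - mean l N) / real N)\<^sup>2)" if "N \<ge> 1" for N
        unfolding power_divide using stat(2)[OF that] by (rule integrable_divide)
      show "eventually (\<lambda>N. (LINT x|E N. (((\<Sum>i<N. x i ^ l) - mean l N) / real N)\<^sup>2) \<le> K * real N powr (-3/2)) sequentially"
        using K eventually_ge_at_top[of 1]
      proof eventually_elim
        case (elim N)
        have "(LINT x|E N. (((\<Sum>i<N. x i ^ l) - mean l N) / real N)\<^sup>2) =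
            (LINT x|E N. ((\<Sum>i<N. x i ^ l) - mean l N)\<^sup>2) / (real N)\<^sup>2"
          unfolding power_divide by (rule integral_divide_zero)
        also have "\<dots> \<le> K * real N powr (1/2) / (real N)\<^sup>2" using elim by (intro divide_right_mono) auto
        also have "\<dots> = K * (real N powr (1/2) / real N powr 2)" using elim by simp
        also have "\<dots> = K * real N powr (1/2 - 2)" by (simp only: powr_diff)
        finally show ?case by simp
      qed
    qed (rule prob)
  qed
  have "AE \<omega> in PiM {1..} E. \<forall>l. (\<lambda>N. ((\<Sum>i<N. \<omega> N i ^ l) - mean l N) / real N) \<longlonglongrightarrow> 0"
    unfolding AE_all_countable by (intro allI centred)
  then show ?thesis
    unfolding E_def[symmetric]
  proof eventually_elim
    case (elim \<omega>)
    \<comment> \<open>The index is shifted because the empirical measure of zero points is an unspecified distribution.\<close>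
    have "weak_conv_m (\<lambda>n. empirical_measure (Suc n) (\<omega> (Suc n))) \<mu>_star"
    proof (rule method_of_moments[OF empirical_measure_real_distribution assms(5,6)])
      show "integrable (empirical_measure (Suc n) (\<omega> (Suc n))) (\<lambda>x. x ^ l)" for n l
        by (rule empirical_measure_moment) simp
      fix l
      have "(\<lambda>N. ((\<Sum>i<N. \<omega> N i ^ l) - mean l N) / real N + mean l N / real N) \<longlonglongrightarrow> 0 + (LINT x|\<mu>_star. x ^ l)"
        by (rule tendsto_add[OF spec[OF elim] mean_lim])
      then have "(\<lambda>N. (\<Sum>i<N. \<omega> N i ^ l) / real N) \<longlonglongrightarrow> (LINT x|\<mu>_star. x ^ l)"
        by (simp flip: add_divide_distrib)
      then have "(\<lambda>n. (\<Sum>i<Suc n. \<omega> (Suc n) i ^ l) / real (Suc n)) \<longlonglongrightarrow> (LINT x|\<mu>_star. x ^ l)"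
        by (rule LIMSEQ_Suc)
      moreover have "(LINT x|empirical_measure (Suc n) (\<omega> (Suc n)). x ^ l) =
          (\<Sum>i<Suc n. \<omega> (Suc n) i ^ l) / real (Suc n)" for n
        by (rule empirical_measure_moment) simp
      ultimately show "(\<lambda>n. LINT x|empirical_measure (Suc n) (\<omega> (Suc n)). x ^ l) \<longlonglongrightarrow> (LINT x|\<mu>_star. x ^ l)"
        by (simp only:)
    qed
    then show ?case
      unfolding weak_conv_m_def weak_conv_def
      by (intro allI impI LIMSEQ_imp_Suc[where f = "\<lambda>N. cdf (empirical_measure N (\<omega> N)) _"]) simp
  qed
qed

end
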